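(* Suppose that $q$ is an odd prime power and $t\ge 3$ is an odd integer. Then the induced subgraph of $\mathrm{AK}(t-1,q)$ on $X_{\boxtimes}/{\sim}$ is a $K_t$-free $(p,\alpha)$-jumbled graph with $p=\Theta\left(n^{-\frac{1}{t-1}}\right)$ and $\alpha=\Theta(\sqrt{np})$, where $n=|X_{\boxtimes}/{\sim}|$.
   Context: $\mathbb{F}_q$ is the finite field with $q$ elements. For $\mathbf{x},\mathbf{y}\in\mathbb{F}_q^t$ let $\mathbf{x}\cdot\mathbf{y}=\sum_{i=1}^t x_iy_i$. $\mathrm{PG}(t-1,q)$ is the $(t-1)$-dimensional projective space over $\mathbb{F}_q$: the set of classes of nonzero vectors of $\mathbb{F}_q^t$ under the relation $\sim$, where $\mathbf{x}\sim\mathbf{y}$ iff $\mathbf{x}=a\mathbf{y}$ for some nonzero $a\in\mathbb{F}_q$. A vector $\mathbf{x}$ (or its class) is absolute if $\mathbf{x}\cdot\mathbf{x}=0$, and non-square if $\mathbf{x}\cdot\mathbf{x}\ne a^2$ for all $a\in\mathbb{F}_q$; both notions depend only on the class of $\mathbf{x}$. $X_{\boxtimes}=X_{\boxtimes}(t,q)$ is the set of non-square vectors in $\mathbb{F}_q^t$, and $X_{\boxtimes}/{\sim}$ is the set of their classes. $\mathrm{AK}(t-1,q)$ is the graph whose vertices are the non-absolute points of $\mathrm{PG}(t-1,q)$, with two vertices (the classes of $\mathbf{x}$ and $\mathbf{y}$) adjacent iff $\mathbf{x}\cdot\mathbf{y}=0$. For a graph $G$ and $X,Y\subset V(G)$,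 $e(X,Y)$ is the number of edges with one vertex in $X$ and one vertex in $Y$, where edges with both vertices in $X\cap Y$ are counted twice. For real $p\in[0,1]$ and $\alpha\ge 0$, $G$ is $(p,\alpha)$-jumbled if $\left|e(X,Y)-p|X||Y|\right|\le\alpha\sqrt{|X||Y|}$ for all $X,Y\subset V(G)$. $K_t$-free means containing no complete subgraph on $t$ vertices. The constants implied by $\Theta(\cdot)$ are positive and may depend on $t$ but not on $q$. *)

theory Defs
  imports
    Complex_Main
    "HOL-Library.FuncSet"
    "HOL-Library.Ramsey"
    "HOL-Algebra.Coset"
    "HOL-Algebra.Ring"
    "HOL-Number_Theory.Prime_Powers"
begin

section \<open>Simple graphs\<close>

text \<open>
  A graph is a pair of its vertex set and its set of edges, the edges being two-element vertex sets.
\<close>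

type_synonym 'v graph = "'v set \<times> 'v set set"

abbreviation verts :: "'v graph \<Rightarrow> 'v set" where "verts \<equiv> fst"
abbreviation edges :: "'v graph \<Rightarrow> 'v set set" where "edges \<equiv> snd"

definition induced :: "'v graph \<Rightarrow> 'v set \<Rightarrow> 'v graph" where
  "induced G W = (verts G \<inter> W, {e \<in> edges G. e \<subseteq> W})"

definition complete_free :: "nat \<Rightarrow> 'v graph \<Rightarrow> bool" where
  "complete_free t G \<longleftrightarrow> \<not> (\<exists>K \<subseteq> verts G. finite K \<and> card K = t \<and> clique K (edges G))"

text \<open>
  The first summand counts each edge between \<open>X\<close> and \<open>Y\<close> once; the second one adds the
  edges inside \<open>X \<inter> Y\<close> again, so that these are counted twice.
\<close>

definition edge_count :: "'v graph \<Rightarrow> 'v set \<Rightarrow> 'v set \<Rightarrow> nat" where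
  "edge_count G X Y =
     card {e \<in> edges G. \<exists>x\<in>X. \<exists>y\<in>Y. e = {x, y}} + card {e \<in> edges G. e \<subseteq> X \<inter> Y}"

definition jumbled :: "real \<Rightarrow> real \<Rightarrow> 'v graph \<Rightarrow> bool" where
  "jumbled p \<alpha> G \<longleftrightarrow> 0 \<le> p \<and> p \<le> 1 \<and> 0 \<le> \<alpha> \<and>
     (\<forall>X Y. X \<subseteq> verts G \<longrightarrow> Y \<subseteq> verts G \<longrightarrow>
        \<bar>real (edge_count G X Y) - p * real (card X) * real (card Y)\<bar>
          \<le> \<alpha> * sqrt (real (card X) * real (card Y)))"

section \<open>Vectors and projective points over a field\<close>

text \<open>
  The field \<open>\<F>\<^sub>q\<close> is an arbitrary field structure \<open>F\<close> with \<open>q\<close> elements.  It is a record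
  and not a type because the constants in the theorem have to be chosen before \<open>q\<close>.  The type
  \<open>'a\<close> of the field elements is arbitrary; for \<open>'a = nat\<close> (or any other infinite type) the
  structures \<open>F\<close> include, up to isomorphism, every finite field.
\<close>

definition vecs :: "nat \<Rightarrow> ('a, 'm) ring_scheme \<Rightarrow> (nat \<Rightarrow> 'a) set" where
  "vecs t F = {1..t} \<rightarrow>\<^sub>E carrier F"

definition dot :: "nat \<Rightarrow> ('a, 'm) ring_scheme \<Rightarrow> (nat \<Rightarrow> 'a) \<Rightarrow> (nat \<Rightarrow> 'a) \<Rightarrow> 'a" where
  "dot t F x y = (\<Oplus>\<^bsub>F\<^esub>i\<in>{1..t}. x i \<otimes>\<^bsub>F\<^esub> y i)"

definition nonzero_vecs :: "nat \<Rightarrow> ('a, 'm) ring_scheme \<Rightarrow> (nat \<Rightarrow> 'a) set" where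
  "nonzero_vecs t F = {x \<in> vecs t F. x \<noteq> (\<lambda>i\<in>{1..t}. \<zero>\<^bsub>F\<^esub>)}"

definition proj_rel :: "nat \<Rightarrow> ('a, 'm) ring_scheme \<Rightarrow> ((nat \<Rightarrow> 'a) \<times> (nat \<Rightarrow> 'a)) set" where
  "proj_rel t F = {(x, y). x \<in> nonzero_vecs t F \<and> y \<in> nonzero_vecs t F \<and>
     (\<exists>a \<in> carrier F. a \<noteq> \<zero>\<^bsub>F\<^esub> \<and> x = (\<lambda>i\<in>{1..t}. a \<otimes>\<^bsub>F\<^esub> y i))}"

text \<open>The points of \<open>PG(t - 1, q)\<close>; \<open>t\<close> is the dimension of the vector space.\<close>

definition proj_points :: "nat \<Rightarrow> ('a, 'm) ring_scheme \<Rightarrow> (nat \<Rightarrow> 'a) set set" where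
  "proj_points t F = nonzero_vecs t F // proj_rel t F"

definition absolute_vec :: "nat \<Rightarrow> ('a, 'm) ring_scheme \<Rightarrow> (nat \<Rightarrow> 'a) \<Rightarrow> bool" where
  "absolute_vec t F x \<longleftrightarrow> dot t F x x = \<zero>\<^bsub>F\<^esub>"

definition nonsquare_vec :: "nat \<Rightarrow> ('a, 'm) ring_scheme \<Rightarrow> (nat \<Rightarrow> 'a) \<Rightarrow> bool" where
  "nonsquare_vec t F x \<longleftrightarrow> (\<forall>a \<in> carrier F. dot t F x x \<noteq> a [^]\<^bsub>F\<^esub> (2::nat))"

definition nonsquare_vecs :: "nat \<Rightarrow> ('a, 'm) ring_scheme \<Rightarrow> (nat \<Rightarrow> 'a) set" where
  "nonsquare_vecs t F = {x \<in> vecs t F. nonsquare_vec t F x}"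

definition nonsquare_points :: "nat \<Rightarrow> ('a, 'm) ring_scheme \<Rightarrow> (nat \<Rightarrow> 'a) set set" where
  "nonsquare_points t F = nonsquare_vecs t F // proj_rel t F"

text \<open>
  The graph \<open>AK(t - 1, q)\<close>.  Orthogonality and absoluteness do not depend on the representatives.
  The condition \<open>P \<noteq> Q\<close> is implied by the others, as no vertex is orthogonal to itself.
\<close>

definition AK :: "nat \<Rightarrow> ('a, 'm) ring_scheme \<Rightarrow> (nat \<Rightarrow> 'a) set graph" where
  "AK t F = (let V = {P \<in> proj_points t F. \<exists>x\<in>P. \<not> absolute_vec t F x} in
     (V, {{P, Q} | P Q. P \<in> V \<and> Q \<in> V \<and> P \<noteq> Q \<and> (\<exists>x\<in>P. \<exists>y\<in>Q. dot t F x y = \<zero>\<^bsub>F\<^esub>)}))"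

end

theory Submission
  imports Defs "HOL-Algebra.Multiplicative_Group" "HOL-Analysis.Convex"
begin

text \<open>
  Let \<open>\<chi>\<close> be the quadratic character. By induction on \<open>m\<close>, the form \<open>x \<bullet> x\<close> in \<open>2 m + 1\<close> variables
  takes the value \<open>c\<close> exactly \<open>q ^ (2 m) + (\<chi>(-1) q) ^ m \<chi>(c)\<close> times. This gives
  \<open>2 n = q ^ (t - 1) \<plusminus> q ^ ((t - 1) / 2)\<close>, and it excludes a clique of size \<open>t\<close>: such a clique yields an
  orthogonal basis whose vectors all have the same non-square norm \<open>d\<close>, so that \<open>x \<bullet> x\<close> would take
  the values \<open>d\<close> and \<open>1\<close> equally often.

  For jumbledness take \<open>p = 1 / q\<close>. The functions \<open>y \<mapsto> [x \<bullet> y = 0] - 1 / q\<close> on the whole vector space,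
  for \<open>x\<close> ranging over distinct projective points, are pairwise orthogonal in \<open>L\<^sup>2\<close>, as two distinct
  hyperplanes meet in \<open>q ^ (t - 2)\<close> vectors. This bounds the second moment of the number of
  neighbours of \<open>y\<close> in \<open>X\<close>, and the Cauchy-Schwarz inequality gives \<open>\<alpha> = q ^ ((t - 2) / 2)\<close>.
\<close>

declare One_nat_def [simp del]

section \<open>The quadratic character\<close>

text \<open>Odd order is the form in which characteristic different from 2 enters;
  \<open>uminus_neq_self\<close> makes it usable.\<close>

locale odd_field = field +
  assumes finite_carrier: "finite (carrier R)"
    and odd_order: "odd (order R)"
begin

abbreviation q :: nat where "q \<equiv> order R"

definition quad_char :: "'a \<Rightarrow> int" where
  "quad_char c = (if c = \<zero> then 0 else if \<exists>a\<in>carrier R. a \<otimes> a = c then 1 else -1)"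

lemma order_ge_3: "q \<ge> 3"
proof -
  have "card {\<zero>, \<one>} \<le> q"
    unfolding order_def by (rule card_mono) (auto simp: finite_carrier)
  moreover have "card {\<zero>, \<one>} = 2" by simp
  ultimately have "q \<ge> 2" by simp
  moreover have "q \<noteq> 2" using odd_order by auto
  ultimately show ?thesis by linarith
qed

text \<open>If -x = x, every even multiple of x vanishes. By Lagrange in the additive group q x = 0,
  and q is odd, so x itself would be zero.\<close>

lemma uminus_neq_self:
  assumes x: "x \<in> carrier R" "x \<noteq> \<zero>"
  shows "\<ominus> x \<noteq> x"
proof
  assume "\<ominus> x = x"
  then have xx: "x \<oplus> x = \<zero>" using x by (metis r_neg)
  have even: "add_pow R (2 * k) x = \<zero>" for k :: nat
    by (induction k) (use x xx in \<open>auto simp: add.nat_pow_Suc a_assoc\<close>)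
  obtain k where k: "q = Suc (2 * k)" using odd_order by (auto elim: oddE)
  have "add_pow R q x = \<zero>"
    using group.pow_order_eq_1[OF a_group, of x] x
    by (simp add: order_def add_pow_def)
  then show False using k even[of k] x by (simp add: add.nat_pow_Suc)
qed

lemma add_eq_iff_eq_minus:
  assumes "u \<in> carrier R" "v \<in> carrier R" "c \<in> carrier R"
  shows "u \<oplus> v = c \<longleftrightarrow> u = c \<ominus> v"
proof -
  have "u \<oplus> v \<ominus> v = u" "c \<ominus> v \<oplus> v = c" using assms by algebra+
  then show ?thesis by auto
qed

text \<open>Phrased as an equivalence so that the solution set of a linear equation inside a count
  collapses to a singleton.\<close>

lemma unique_linear_solution:
  assumes "x \<in> carrier R" "x \<noteq> \<zero>" "a \<in> carrier R"
  obtains s where "s \<in> carrier R" "\<And>r. r \<in> carrier R \<Longrightarrow> x \<otimes> r = a \<longleftrightarrow> r = s"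
proof
  have i: "inv x \<in> carrier R" "x \<otimes> inv x = \<one>" using assms field_Units by auto
  then show "inv x \<otimes> a \<in> carrier R" using assms by simp
  have "x \<otimes> (inv x \<otimes> a) = a" using i assms by (simp flip: m_assoc)
  then show "x \<otimes> r = a \<longleftrightarrow> r = inv x \<otimes> a" if "r \<in> carrier R" for r
    using assms i that m_lcancel[of x r "inv x \<otimes> a"] by auto
qed

lemma square_eq_iff:
  assumes "x \<in> carrier R" "y \<in> carrier R"
  shows "x \<otimes> x = y \<otimes> y \<longleftrightarrow> x = y \<or> x = \<ominus> y"
proof
  assume eq: "x \<otimes> x = y \<otimes> y"
  have "(x \<oplus> y) \<otimes> (x \<ominus> y) = x \<otimes> x \<ominus> y \<otimes> y"
    using assms by algebra
  also have "\<dots> = \<zero>" using eq assms by (simp add: a_minus_def r_neg)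
  finally have "x \<oplus> y = \<zero> \<or> x \<oplus> (\<ominus> y) = \<zero>"
    using assms integral by (auto simp: a_minus_def)
  then show "x = y \<or> x = \<ominus> y" using assms
    by (metis minus_equality minus_minus a_inv_closed)
qed (use assms in \<open>auto simp: l_minus r_minus\<close>)

text \<open>The roots of a square are a and -a, which coincide only at zero. This turns sums over
  squares s s into sums over all r with weight 1 + \<chi>(r).\<close>

lemma card_square_roots:
  assumes "c \<in> carrier R"
  shows "int (card {x \<in> carrier R. x \<otimes> x = c}) = 1 + quad_char c"
proof (cases "\<exists>a\<in>carrier R. a \<otimes> a = c")
  case True
  then obtain a where a: "a \<in> carrier R" "a \<otimes> a = c" by auto
  have "{x \<in> carrier R. x \<otimes> x = c} = {a, \<ominus> a}" using a square_eq_iff by auto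
  moreover have "a = \<zero> \<longleftrightarrow> c = \<zero>" using a integral by auto
  ultimately show ?thesis
    using True a uminus_neq_self[of a] by (cases "c = \<zero>") (auto simp: quad_char_def)
next
  case False
  then have empty: "{x \<in> carrier R. x \<otimes> x = c} = {}" and "c \<noteq> \<zero>"
    by (auto dest: bspec[of _ _ \<zero>])
  with False show ?thesis unfolding empty by (simp add: quad_char_def)
qed

text \<open>Every x is a square root of exactly one c, so the root counts 1 + \<chi>(c) add up to
  q.\<close>

lemma sum_quad_char: "(\<Sum>c\<in>carrier R. quad_char c) = 0"
proof -
  have "(\<Sum>c\<in>carrier R. \<Sum>x\<in>{x \<in> carrier R. x \<otimes> x = c}. (1::int)) = (\<Sum>x\<in>carrier R. 1)"
    by (rule sum.group) (auto simp: finite_carrier)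
  then have "(\<Sum>c\<in>carrier R. 1 + quad_char c) = int q"
    by (simp add: order_def card_square_roots)
  then show ?thesis by (simp add: sum.distrib order_def)
qed

lemma quad_char_zero [simp]: "quad_char \<zero> = 0"
  by (simp add: quad_char_def)

lemma quad_char_one [simp]: "quad_char \<one> = 1"
  by (auto simp: quad_char_def intro: bexI[of _ \<one>])

lemma quad_char_nonzero: "c \<noteq> \<zero> \<Longrightarrow> quad_char c = 1 \<or> quad_char c = -1"
  by (simp add: quad_char_def)

lemma quad_char_eq_1_iff: "quad_char c = 1 \<longleftrightarrow> c \<noteq> \<zero> \<and> (\<exists>a\<in>carrier R. a \<otimes> a = c)"
  by (simp add: quad_char_def)

lemma quad_char_eq_m1_iff: "quad_char c = -1 \<longleftrightarrow> (\<forall>a\<in>carrier R. a \<otimes> a \<noteq> c)"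
  by (auto simp: quad_char_def dest: bspec[of _ _ \<zero>])

text \<open>Partitioning the field into zero, nonzero squares and non-squares gives the sum of the
  two sizes; the vanishing of the character sum makes them equal.\<close>

lemma card_quad_char:
  "2 * card {c \<in> carrier R. quad_char c = 1} = q - 1"
  "2 * card {c \<in> carrier R. quad_char c = -1} = q - 1"
proof -
  let ?S = "{c \<in> carrier R. quad_char c = 1}" and ?N = "{c \<in> carrier R. quad_char c = -1}"
  have eq: "carrier R = insert \<zero> (?S \<union> ?N)" using quad_char_nonzero by force
  have "q = card (insert \<zero> (?S \<union> ?N))" using eq order_def by metis
  also have "\<dots> = 1 + (card ?S + card ?N)"
    by (subst card_insert_disjoint, (simp add: finite_carrier)+)
       (intro card_Un_disjoint, auto simp: finite_carrier)
  finally have 1: "q = 1 + (card ?S + card ?N)" .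
  have "0 = (\<Sum>c\<in>insert \<zero> (?S \<union> ?N). quad_char c)" using eq sum_quad_char by metis
  also have "\<dots> = int (card ?S) - int (card ?N)"
    by (subst sum.insert, (simp add: finite_carrier)+)
       (subst sum.union_disjoint, auto simp: finite_carrier)
  finally have "card ?S = card ?N" by simp
  with 1 show "2 * card ?S = q - 1" "2 * card ?N = q - 1" by auto
qed

lemma square_mult_square:
  assumes "x \<in> carrier R" "y \<in> carrier R"
  shows "(x \<otimes> y) \<otimes> (x \<otimes> y) = (x \<otimes> x) \<otimes> (y \<otimes> y)"
  using assms by algebra

text \<open>Multiplication by a carries the square roots of b to those of a a b, and multiplication
  by the inverse of a carries them back.\<close>

lemma quad_char_square_mult:
  assumes a: "a \<in> carrier R" "a \<noteq> \<zero>" and b: "b \<in> carrier R"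
  shows "quad_char (a \<otimes> a \<otimes> b) = quad_char b"
proof -
  have i: "inv a \<in> carrier R" "inv a \<otimes> a = \<one>" using a field_Units by auto
  have "(\<exists>x\<in>carrier R. x \<otimes> x = a \<otimes> a \<otimes> b) \<longleftrightarrow> (\<exists>x\<in>carrier R. x \<otimes> x = b)"
  proof
    assume "\<exists>x\<in>carrier R. x \<otimes> x = a \<otimes> a \<otimes> b"
    then obtain x where x: "x \<in> carrier R" "x \<otimes> x = a \<otimes> a \<otimes> b" by blast
    have "(inv a \<otimes> x) \<otimes> (inv a \<otimes> x) = (inv a \<otimes> inv a) \<otimes> (a \<otimes> a \<otimes> b)"
      using square_mult_square[OF i(1) x(1)] x by simp
    also have "\<dots> = (inv a \<otimes> a) \<otimes> (inv a \<otimes> a) \<otimes> b"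
      using i(1) a b by (simp add: m_ac)
    also have "\<dots> = b" using i b by simp
    finally show "\<exists>x\<in>carrier R. x \<otimes> x = b" using i x by blast
  next
    assume "\<exists>x\<in>carrier R. x \<otimes> x = b"
    then show "\<exists>x\<in>carrier R. x \<otimes> x = a \<otimes> a \<otimes> b" using a square_mult_square by (metis m_closed)
  qed
  moreover have "a \<otimes> a \<otimes> b = \<zero> \<longleftrightarrow> b = \<zero>"
    using a b by (metis integral m_closed r_null)
  ultimately show ?thesis by (simp add: quad_char_def)
qed

text \<open>Multiplication by a non-square maps the nonzero squares injectively into the non-squares,
  which are equally many, hence onto them.\<close>

lemma quad_char_mult:
  assumes a: "a \<in> carrier R" and b: "b \<in> carrier R"
  shows "quad_char (a \<otimes> b) = quad_char a * quad_char b"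
proof -
  let ?S = "{c \<in> carrier R. quad_char c = 1}" and ?N = "{c \<in> carrier R. quad_char c = -1}"
  have sq: "quad_char (x \<otimes> y) = quad_char y"
    if "x \<in> carrier R" "y \<in> carrier R" "quad_char x = 1" for x y
    using that quad_char_square_mult[of _ y] by (force simp: quad_char_eq_1_iff)
  consider "a = \<zero>" | "b = \<zero>" | "quad_char a = 1" | "quad_char b = 1"
    | "quad_char a = -1" "quad_char b = -1"
    using quad_char_nonzero by blast
  then show ?thesis
  proof cases
    case 5
    have "a \<noteq> \<zero>" using 5 by auto
    have cancel: "x = y" if "a \<otimes> x = a \<otimes> y" "x \<in> carrier R" "y \<in> carrier R" for x y
      using that a \<open>a \<noteq> \<zero>\<close> m_lcancel by blast
    have "(\<lambda>c. a \<otimes> c) ` ?S \<subseteq> ?N" using a 5 sq m_comm by fastforce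
    moreover have "card ((\<lambda>c. a \<otimes> c) ` ?S) = card ?N"
      using card_quad_char by (subst card_image) (auto intro!: inj_onI cancel)
    ultimately have onto: "(\<lambda>c. a \<otimes> c) ` ?S = ?N"
      by (intro card_subset_eq) (auto simp: finite_carrier)
    have "b \<noteq> \<zero>" using 5 by auto
    then have "a \<otimes> b \<noteq> \<zero>" using a b \<open>a \<noteq> \<zero>\<close> integral by blast
    moreover have "quad_char (a \<otimes> b) \<noteq> -1"
    proof
      assume "quad_char (a \<otimes> b) = -1"
      then have "a \<otimes> b \<in> (\<lambda>c. a \<otimes> c) ` ?S" using onto a b by auto
      then have "b \<in> ?S" using cancel b by auto
      then show False using 5 by simp
    qed
    ultimately show ?thesis using 5 quad_char_nonzero[of "a \<otimes> b"] by auto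
  qed (use a b sq m_comm in force)+
qed

section \<open>Jacobi sums of the quadratic character\<close>

lemma bij_mult: "a \<in> carrier R \<Longrightarrow> a \<noteq> \<zero> \<Longrightarrow> bij_betw (\<lambda>x. a \<otimes> x) (carrier R) (carrier R)"
  by (intro bij_betwI[where g = "\<lambda>x. inv a \<otimes> x"])
     (auto simp: field_Units m_assoc[symmetric])

lemma minus_minus_cancel: "c \<in> carrier R \<Longrightarrow> x \<in> carrier R \<Longrightarrow> c \<ominus> (c \<ominus> x) = x"
  by algebra

lemma bij_minus: "c \<in> carrier R \<Longrightarrow> bij_betw (\<lambda>x. c \<ominus> x) (carrier R) (carrier R)"
  by (rule bij_betwI[where g = "\<lambda>x. c \<ominus> x"]) (auto simp: minus_minus_cancel)

text \<open>The additive convolution of \<chi> with itself; at \<open>\<one>\<close> it is the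
  classical Jacobi sum J(\<chi>, \<chi>).\<close>

definition jacobi_sum :: "'a \<Rightarrow> int" where
  "jacobi_sum c = (\<Sum>s\<in>carrier R. quad_char (c \<ominus> s) * quad_char s)"

text \<open>Here \<chi>(-s) \<chi>(s) = \<chi>(-1) \<chi>(s)^2, and \<chi>(s)^2 is 1 away from
  zero.\<close>

lemma jacobi_sum_zero: "jacobi_sum \<zero> = quad_char (\<ominus> \<one>) * (int q - 1)"
proof -
  have "quad_char (\<zero> \<ominus> s) * quad_char s = quad_char (\<ominus> \<one>) * of_bool (s \<noteq> \<zero>)"
    if "s \<in> carrier R" for s
  proof -
    have "\<zero> \<ominus> s = \<ominus> \<one> \<otimes> s" using that by algebra
    then have "quad_char (\<zero> \<ominus> s) * quad_char s = quad_char (\<ominus> \<one>) * (quad_char s * quad_char s)"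
      using that by (simp add: quad_char_mult)
    then show ?thesis using quad_char_nonzero[of s] by auto
  qed
  then have "jacobi_sum \<zero> = quad_char (\<ominus> \<one>) * (\<Sum>s\<in>carrier R. of_bool (s \<noteq> \<zero>))"
    by (simp add: jacobi_sum_def sum_distrib_left)
  also have "(\<Sum>s\<in>carrier R. of_bool (s \<noteq> \<zero>)) = int (card (carrier R - {\<zero>}))"
    using finite_carrier by (simp add: sum.If_cases of_bool_def Int_def set_diff_eq)
  also have "\<dots> = int q - 1"
    using finite_carrier order_ge_3 by (simp add: order_def of_nat_diff)
  finally show ?thesis .
qed

text \<open>Substituting a s for s produces the factor \<chi>(a)^2 = 1, so all nonzero arguments
  share one value. The total over all arguments is zero because \<chi> sums to zero, hence the value
  at zero determines the common one.\<close>

lemma jacobi_sum_nonzero: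
  assumes c: "c \<in> carrier R" "c \<noteq> \<zero>"
  shows "jacobi_sum c = - quad_char (\<ominus> \<one>)"
proof -
  have scale: "jacobi_sum a = jacobi_sum \<one>" if a: "a \<in> carrier R" "a \<noteq> \<zero>" for a
  proof -
    have "jacobi_sum a = (\<Sum>s\<in>carrier R. quad_char (a \<ominus> a \<otimes> s) * quad_char (a \<otimes> s))"
      unfolding jacobi_sum_def by (rule sum.reindex_bij_betw[OF bij_mult[OF a], symmetric])
    also have "\<dots> = (\<Sum>s\<in>carrier R. quad_char (\<one> \<ominus> s) * quad_char s)"
    proof (rule sum.cong[OF refl])
      fix s assume s: "s \<in> carrier R"
      have "a \<ominus> a \<otimes> s = a \<otimes> (\<one> \<ominus> s)" using a s by algebra
      then show "quad_char (a \<ominus> a \<otimes> s) * quad_char (a \<otimes> s) = quad_char (\<one> \<ominus> s) * quad_char s"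
        using a s quad_char_nonzero[of a] by (auto simp: quad_char_mult)
    qed
    finally show ?thesis by (simp add: jacobi_sum_def)
  qed
  have "(\<Sum>a\<in>carrier R. jacobi_sum a)
      = (\<Sum>s\<in>carrier R. \<Sum>a\<in>carrier R. quad_char (a \<ominus> s) * quad_char s)"
    unfolding jacobi_sum_def by (rule sum.swap)
  also have "\<dots> = (\<Sum>s\<in>carrier R. 0)"
  proof (rule sum.cong[OF refl])
    fix s assume s: "s \<in> carrier R"
    have "bij_betw (\<lambda>a. a \<ominus> s) (carrier R) (carrier R)"
    proof (rule bij_betwI[where g = "\<lambda>a. a \<oplus> s"])
      fix x assume "x \<in> carrier R"
      with s show "x \<ominus> s \<oplus> s = x" "x \<oplus> s \<ominus> s = x" by algebra+
    qed (use s in auto)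
    then have "(\<Sum>a\<in>carrier R. quad_char (a \<ominus> s)) = (\<Sum>a\<in>carrier R. quad_char a)"
      by (rule sum.reindex_bij_betw)
    then show "(\<Sum>a\<in>carrier R. quad_char (a \<ominus> s) * quad_char s) = 0"
      by (simp add: sum_quad_char flip: sum_distrib_right)
  qed
  finally have "0 = (\<Sum>a\<in>carrier R. jacobi_sum a)" by simp
  also have "\<dots> = jacobi_sum \<zero> + (\<Sum>a\<in>carrier R - {\<zero>}. jacobi_sum a)"
    by (rule sum.remove) (auto simp: finite_carrier)
  also have "(\<Sum>a\<in>carrier R - {\<zero>}. jacobi_sum a) = (\<Sum>a\<in>carrier R - {\<zero>}. jacobi_sum \<one>)"
    by (rule sum.cong[OF refl], rule scale) auto
  also have "\<dots> = (int q - 1) * jacobi_sum \<one>"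
    using finite_carrier order_ge_3 by (simp add: order_def of_nat_diff)
  finally have "(int q - 1) * (jacobi_sum \<one> + quad_char (\<ominus> \<one>)) = 0"
    unfolding jacobi_sum_zero by (metis add.commute distrib_left mult.commute)
  then have "jacobi_sum \<one> + quad_char (\<ominus> \<one>) = 0"
    using order_ge_3 unfolding mult_eq_0_iff by auto
  then show ?thesis using scale[OF c] by auto
qed

section \<open>Representations by sums of squares\<close>

lemma vecs_closed: "x \<in> vecs t R \<Longrightarrow> x \<in> {1..t} \<rightarrow> carrier R"
  by (auto simp: vecs_def)

lemma finite_vecs: "finite (vecs t R)"
  by (auto simp: vecs_def intro!: finite_PiE finite_carrier)

lemma card_vecs: "card (vecs t R) = q ^ t"
  by (simp add: vecs_def card_funcsetE order_def)

lemma vecs_nth: "x \<in> vecs t R \<Longrightarrow> 1 \<le> i \<Longrightarrow> i \<le> t \<Longrightarrow> x i \<in> carrier R"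
  by (auto simp: vecs_def)

lemma vecs_eqI:
  assumes "x \<in> vecs t R" "y \<in> vecs t R" "\<And>i. i \<in> {1..t} \<Longrightarrow> x i = y i"
  shows "x = y"
  using assms unfolding vecs_def PiE_def by (intro extensionalityI[of x "{1..t}" y]) auto

lemma atLeast1_atMost_Suc: "{1..Suc t} = insert (Suc t) {1..t}"
  by auto

lemma bij_vecs_Suc:
  "bij_betw (\<lambda>(s, y). y(Suc t := s)) (carrier R \<times> vecs t R) (vecs (Suc t) R)"
proof -
  have "(\<lambda>(s, y). y(Suc t := s)) ` (carrier R \<times> vecs t R) = vecs (Suc t) R"
    unfolding vecs_def atLeast1_atMost_Suc by (rule PiE_insert_eq[symmetric])
  moreover have "inj_on (\<lambda>(s, y). y(Suc t := s)) (carrier R \<times> vecs t R)"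
    unfolding vecs_def by (rule inj_combinator) auto
  ultimately show ?thesis by (simp add: bij_betw_def)
qed

text \<open>Fibring over the last coordinate; both inductions on the dimension, for
  \<open>rep_count\<close> and for hyperplanes, start from it.\<close>

lemma card_vecs_Suc_filter:
  "card {x \<in> vecs (Suc t) R. P x} = (\<Sum>s\<in>carrier R. card {y \<in> vecs t R. P (y(Suc t := s))})"
proof -
  have "bij_betw (\<lambda>(s, y). y(Suc t := s))
      {z \<in> carrier R \<times> vecs t R. P ((snd z)(Suc t := fst z))} {x \<in> vecs (Suc t) R. P x}"
    by (rule bij_betw_Collect[OF bij_vecs_Suc]) auto
  also have "{z \<in> carrier R \<times> vecs t R. P ((snd z)(Suc t := fst z))}
      = (SIGMA s:carrier R. {y \<in> vecs t R. P (y(Suc t := s))})" by auto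
  finally have "bij_betw (\<lambda>(s, y). y(Suc t := s))
      (SIGMA s:carrier R. {y \<in> vecs t R. P (y(Suc t := s))}) {x \<in> vecs (Suc t) R. P x}" .
  then have "card {x \<in> vecs (Suc t) R. P x}
      = card (SIGMA s:carrier R. {y \<in> vecs t R. P (y(Suc t := s))})"
    by (rule bij_betw_same_card[symmetric])
  then show ?thesis using finite_carrier finite_vecs by (simp add: card_SigmaI)
qed

lemma dot_closed:
  "x \<in> {1..t} \<rightarrow> carrier R \<Longrightarrow> y \<in> {1..t} \<rightarrow> carrier R \<Longrightarrow> dot t R x y \<in> carrier R"
  unfolding dot_def by (rule finsum_closed) auto

lemma dot_vecs_closed: "x \<in> vecs t R \<Longrightarrow> y \<in> vecs t R \<Longrightarrow> dot t R x y \<in> carrier R"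
  by (intro dot_closed vecs_closed)

lemma dot_cong:
  assumes "x' \<in> {1..t} \<rightarrow> carrier R" "y' \<in> {1..t} \<rightarrow> carrier R"
    and "\<And>i. i \<in> {1..t} \<Longrightarrow> x i = x' i" "\<And>i. i \<in> {1..t} \<Longrightarrow> y i = y' i"
  shows "dot t R x y = dot t R x' y'"
  unfolding dot_def by (rule finsum_cong') (use assms in auto)

lemma dot_commute:
  assumes "x \<in> {1..t} \<rightarrow> carrier R" "y \<in> {1..t} \<rightarrow> carrier R"
  shows "dot t R x y = dot t R y x"
  unfolding dot_def by (rule finsum_cong') (use assms in \<open>auto intro!: m_comm\<close>)

lemma dot_Suc:
  assumes "x \<in> {1..Suc t} \<rightarrow> carrier R" "y \<in> {1..Suc t} \<rightarrow> carrier R"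
  shows "dot (Suc t) R x y = dot t R x y \<oplus> x (Suc t) \<otimes> y (Suc t)"
proof -
  have "dot (Suc t) R x y = x (Suc t) \<otimes> y (Suc t) \<oplus> dot t R x y"
    unfolding dot_def atLeast1_atMost_Suc
    by (rule finsum_insert) (use assms in \<open>auto simp: Pi_iff\<close>)
  moreover have "dot t R x y \<in> carrier R" by (rule dot_closed) (use assms in auto)
  moreover have "x (Suc t) \<in> carrier R" "y (Suc t) \<in> carrier R" using assms by auto
  ultimately show ?thesis by (simp add: a_comm)
qed

lemma dot_zero:
  assumes "y \<in> {1..t} \<rightarrow> carrier R" "\<And>i. i \<in> {1..t} \<Longrightarrow> x i = \<zero>"
  shows "dot t R x y = \<zero>"
proof -
  have "dot t R x y = (\<Oplus>i\<in>{1..t}. \<zero>)"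
    unfolding dot_def by (rule finsum_cong') (use assms in \<open>auto simp: Pi_iff\<close>)
  then show ?thesis by simp
qed

lemma dot_upd_Suc:
  assumes "x \<in> vecs t R" "y \<in> vecs t R" "a \<in> carrier R" "b \<in> carrier R"
  shows "dot (Suc t) R (x(Suc t := a)) (y(Suc t := b)) = dot t R x y \<oplus> a \<otimes> b"
proof -
  have "dot (Suc t) R (x(Suc t := a)) (y(Suc t := b))
      = dot t R (x(Suc t := a)) (y(Suc t := b)) \<oplus> a \<otimes> b"
    using assms by (subst dot_Suc) (auto simp: vecs_def Pi_iff)
  also have "dot t R (x(Suc t := a)) (y(Suc t := b)) = dot t R x y"
    using assms by (intro dot_cong vecs_closed) auto
  finally show ?thesis .
qed

text \<open>Only x carries a coefficient: letting a vary with x and z fixed is what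
  \<open>card_orthogonal_pair\<close> counts over. The restriction keeps the result extensional,
  hence inside \<open>vecs\<close>.\<close>

definition lincomb :: "nat \<Rightarrow> 'a \<Rightarrow> (nat \<Rightarrow> 'a) \<Rightarrow> (nat \<Rightarrow> 'a) \<Rightarrow> nat \<Rightarrow> 'a" where
  "lincomb t a x z = (\<lambda>i\<in>{1..t}. a \<otimes> x i \<oplus> z i)"

lemma lincomb_closed:
  "a \<in> carrier R \<Longrightarrow> x \<in> vecs t R \<Longrightarrow> z \<in> vecs t R \<Longrightarrow> lincomb t a x z \<in> vecs t R"
  by (auto simp: lincomb_def vecs_def)

lemma dot_lincomb:
  assumes "a \<in> carrier R" "x \<in> vecs t R" "z \<in> vecs t R" "y \<in> vecs t R"
  shows "dot t R (lincomb t a x z) y = a \<otimes> dot t R x y \<oplus> dot t R z y"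
proof -
  have c: "x i \<in> carrier R" "y i \<in> carrier R" "z i \<in> carrier R" if "i \<in> {1..t}" for i
    using that assms by (auto simp: vecs_def)
  have "dot t R (lincomb t a x z) y = (\<Oplus>i\<in>{1..t}. a \<otimes> (x i \<otimes> y i) \<oplus> z i \<otimes> y i)"
    unfolding dot_def by (rule finsum_cong')
      (use c assms in \<open>auto simp: lincomb_def l_distr m_assoc\<close>)
  also have "\<dots> = (\<Oplus>i\<in>{1..t}. a \<otimes> (x i \<otimes> y i)) \<oplus> (\<Oplus>i\<in>{1..t}. z i \<otimes> y i)"
    by (rule finsum_addf) (use c assms in auto)
  also have "(\<Oplus>i\<in>{1..t}. a \<otimes> (x i \<otimes> y i)) = a \<otimes> dot t R x y"
    unfolding dot_def by (rule finsum_rdistr[symmetric]) (use c assms in auto)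
  finally show ?thesis by (simp add: dot_def)
qed

definition scale :: "nat \<Rightarrow> 'a \<Rightarrow> (nat \<Rightarrow> 'a) \<Rightarrow> nat \<Rightarrow> 'a" where
  "scale t a x = (\<lambda>i\<in>{1..t}. a \<otimes> x i)"

lemma scale_closed: "a \<in> carrier R \<Longrightarrow> x \<in> vecs t R \<Longrightarrow> scale t a x \<in> vecs t R"
  by (auto simp: scale_def vecs_def)

lemma dot_scale_left:
  assumes "a \<in> carrier R" "x \<in> vecs t R" "y \<in> vecs t R"
  shows "dot t R (scale t a x) y = a \<otimes> dot t R x y"
proof -
  have c: "x i \<in> carrier R" "y i \<in> carrier R" if "i \<in> {1..t}" for i
    using that assms by (auto simp: vecs_def)
  have "dot t R (scale t a x) y = (\<Oplus>i\<in>{1..t}. a \<otimes> (x i \<otimes> y i))"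
    unfolding dot_def by (rule finsum_cong') (use c assms in \<open>auto simp: scale_def m_assoc\<close>)
  also have "\<dots> = a \<otimes> dot t R x y"
    unfolding dot_def by (rule finsum_rdistr[symmetric]) (use c assms in auto)
  finally show ?thesis .
qed

lemma dot_scale_right:
  assumes "a \<in> carrier R" "x \<in> vecs t R" "y \<in> vecs t R"
  shows "dot t R x (scale t a y) = a \<otimes> dot t R x y"
  using assms by (metis dot_commute dot_scale_left scale_closed vecs_closed)

section \<open>Numbers of representations by a sum of t squares\<close>

definition rep_count :: "nat \<Rightarrow> 'a \<Rightarrow> nat" where
  "rep_count t c = card {x \<in> vecs t R. dot t R x x = c}"

text \<open>The last coordinate s is grouped by its square r, and there are 1 + \<chi>(r) choices of
  s for each r.\<close>

lemma rep_count_Suc: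
  assumes c: "c \<in> carrier R"
  shows "int (rep_count (Suc t) c)
    = (\<Sum>r\<in>carrier R. int (rep_count t (c \<ominus> r)) * (1 + quad_char r))"
proof -
  have eq: "{y \<in> vecs t R. dot (Suc t) R (y(Suc t := s)) (y(Suc t := s)) = c}
      = {y \<in> vecs t R. dot t R y y = c \<ominus> s \<otimes> s}" if s: "s \<in> carrier R" for s
  proof -
    show ?thesis using s c by (intro Collect_cong)
      (metis add_eq_iff_eq_minus dot_upd_Suc dot_vecs_closed m_closed)
  qed
  have "int (rep_count (Suc t) c) = (\<Sum>s\<in>carrier R. int (rep_count t (c \<ominus> s \<otimes> s)))"
    unfolding rep_count_def card_vecs_Suc_filter by (simp add: eq)
  also have "\<dots> = (\<Sum>r\<in>carrier R. \<Sum>s\<in>{s \<in> carrier R. s \<otimes> s = r}. int (rep_count t (c \<ominus> s \<otimes> s)))"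
    by (rule sum.group[symmetric]) (auto simp: finite_carrier)
  also have "\<dots> = (\<Sum>r\<in>carrier R. int (rep_count t (c \<ominus> r)) * (1 + quad_char r))"
    by (rule sum.cong[OF refl]) (simp flip: card_square_roots)
  finally show ?thesis .
qed

lemma sum_quad_char_minus:
  assumes "c \<in> carrier R"
  shows "(\<Sum>r\<in>carrier R. quad_char (c \<ominus> r)) = 0"
  using sum.reindex_bij_betw[OF bij_minus[OF assms], of quad_char] sum_quad_char by simp

lemma rep_count_0: "rep_count 0 c = of_bool (c = \<zero>)"
  by (auto simp: rep_count_def vecs_def dot_def)

text \<open>One expression for both cases, affine in the indicator of \<open>c = \<zero>\<close>:
  this is the shape passed between the two step lemmas.\<close>

lemma jacobi_sum_eq:
  assumes "c \<in> carrier R"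
  shows "jacobi_sum c = quad_char (\<ominus> \<one>) * (of_bool (c = \<zero>) * int q - 1)"
  using assms jacobi_sum_zero jacobi_sum_nonzero by auto

lemma minus_eq_zero_iff:
  "c \<in> carrier R \<Longrightarrow> r \<in> carrier R \<Longrightarrow> c \<ominus> r = \<zero> \<longleftrightarrow> r = c"
  by auto

lemma rep_count_1:
  assumes c: "c \<in> carrier R"
  shows "int (rep_count (Suc 0) c) = 1 + quad_char c"
proof -
  have "int (rep_count (Suc 0) c) = (\<Sum>r\<in>carrier R. if r = c then 1 + quad_char r else 0)"
    unfolding rep_count_Suc[OF c] rep_count_0 using c
    by (intro sum.cong) (auto simp: minus_eq_zero_iff)
  then show ?thesis using c finite_carrier by simp
qed

text \<open>After expansion the terms linear in \<chi> sum to zero; the only surviving cross term is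
  a Jacobi sum. The hypothesis is the shape for an odd number of variables, the conclusion that for
  an even number.\<close>

lemma rep_count_step_even:
  assumes c: "c \<in> carrier R"
    and t: "\<And>c. c \<in> carrier R \<Longrightarrow> int (rep_count t c) = A + B * quad_char c"
  shows "int (rep_count (Suc t) c)
    = A * int q + B * quad_char (\<ominus> \<one>) * (of_bool (c = \<zero>) * int q - 1)"
proof -
  have "int (rep_count (Suc t) c)
      = (\<Sum>r\<in>carrier R. (A + B * quad_char (c \<ominus> r)) * (1 + quad_char r))"
    unfolding rep_count_Suc[OF c] using c by (intro sum.cong) (auto simp: t)
  also have "\<dots> = (\<Sum>r\<in>carrier R. A + A * quad_char r + B * quad_char (c \<ominus> r)
      + B * (quad_char (c \<ominus> r) * quad_char r))"
    by (intro sum.cong) (auto simp: algebra_simps)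
  also have "\<dots> = A * int q + B * jacobi_sum c"
    using sum_quad_char_minus[OF c] sum_quad_char
    by (simp add: sum.distrib jacobi_sum_def order_def flip: sum_distrib_left)
  finally show ?thesis using c by (simp add: jacobi_sum_eq mult.assoc)
qed

text \<open>The point mass at r = c contributes B q (1 + \<chi>(c)). Its part B q cancels the -B
  occurring in each of the q terms, so that only B q \<chi>(c) deviates from the mean.\<close>

lemma rep_count_step_odd:
  assumes c: "c \<in> carrier R"
    and t: "\<And>c. c \<in> carrier R \<Longrightarrow>
      int (rep_count t c) = A + B * (of_bool (c = \<zero>) * int q - 1)"
  shows "int (rep_count (Suc t) c) = A * int q + B * int q * quad_char c"
proof -
  have "int (rep_count (Suc t) c)
      = (\<Sum>r\<in>carrier R. (A + B * (of_bool (r = c) * int q - 1)) * (1 + quad_char r))"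
    unfolding rep_count_Suc[OF c] using c by (intro sum.cong) (auto simp: t minus_eq_zero_iff)
  also have "\<dots> = (\<Sum>r\<in>carrier R. (A - B) + (A - B) * quad_char r
      + (if r = c then B * int q * (1 + quad_char r) else 0))"
    by (intro sum.cong) (auto simp: algebra_simps)
  also have "\<dots> = (A - B) * int q + B * int q * (1 + quad_char c)"
    using sum_quad_char c finite_carrier
    by (simp add: sum.distrib order_def flip: sum_distrib_left)
  finally show ?thesis by (simp add: algebra_simps)
qed

text \<open>Since the Jacobi sum is constant off \<open>\<zero>\<close>, the deviation of \<open>rep_count\<close> from its mean
  reproduces itself up to the factor \<open>\<chi>(-1) q\<close> when two variables are added.\<close>

lemma rep_count_odd:
  assumes "c \<in> carrier R"
  shows "int (rep_count (2 * m + 1) c)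
    = int q ^ (2 * m) + (quad_char (\<ominus> \<one>) * int q) ^ m * quad_char c"
  using assms
proof (induction m arbitrary: c)
  case 0
  then show ?case using rep_count_1 by (simp add: One_nat_def)
next
  case (Suc m)
  \<comment> \<open>The two explicit successors let the odd step and the even step apply in turn,
    with A and B found by unification.\<close>
  have "int (rep_count (Suc (Suc (2 * m + 1))) c)
      = int q ^ (2 * m) * int q * int q
        + (quad_char (\<ominus> \<one>) * int q) ^ m * quad_char (\<ominus> \<one>) * int q * quad_char c"
    by (intro rep_count_step_odd rep_count_step_even Suc)
  then show ?case by (simp add: algebra_simps)
qed

section \<open>Orthogonal bases of constant norm\<close>

lemma dot_finsum_left:
  assumes "finite K" and c: "c \<in> K \<rightarrow> carrier R" and b: "b \<in> K \<rightarrow> vecs t R" and y: "y \<in> vecs t R"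
  shows "dot t R (\<lambda>i\<in>{1..t}. \<Oplus>k\<in>K. c k \<otimes> b k i) y = (\<Oplus>k\<in>K. c k \<otimes> dot t R (b k) y)"
  using assms
proof (induction K rule: finite_induct)
  case empty
  then show ?case by (auto intro!: dot_zero vecs_closed)
next
  case (insert k K)
  let ?z = "\<lambda>i\<in>{1..t}. \<Oplus>k\<in>K. c k \<otimes> b k i"
  have bi: "b l i \<in> carrier R" if "l \<in> insert k K" "i \<in> {1..t}" for l i
    using funcset_mem[OF insert.prems(2) that(1)] that(2) by (auto simp: vecs_def)
  have z: "?z \<in> vecs t R"
    using bi insert.prems by (auto simp: vecs_def intro!: finsum_closed)
  have "(\<lambda>i\<in>{1..t}. \<Oplus>k\<in>insert k K. c k \<otimes> b k i) = lincomb t (c k) (b k) ?z"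
    unfolding lincomb_def
  proof (rule restrict_ext)
    fix i assume i: "i \<in> {1..t}"
    then have "(\<Oplus>k\<in>insert k K. c k \<otimes> b k i) = c k \<otimes> b k i \<oplus> (\<Oplus>k\<in>K. c k \<otimes> b k i)"
      using bi insert by (intro finsum_insert) auto
    then show "(\<Oplus>k\<in>insert k K. c k \<otimes> b k i) = c k \<otimes> b k i \<oplus> ?z i" using i by simp
  qed
  then have "dot t R (\<lambda>i\<in>{1..t}. \<Oplus>k\<in>insert k K. c k \<otimes> b k i) y
      = c k \<otimes> dot t R (b k) y \<oplus> dot t R ?z y"
    using insert.prems z by (simp add: dot_lincomb)
  also have "dot t R ?z y = (\<Oplus>k\<in>K. c k \<otimes> dot t R (b k) y)"
    by (rule insert.IH) (use insert.prems in auto)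
  also have "c k \<otimes> dot t R (b k) y \<oplus> \<dots> = (\<Oplus>k\<in>insert k K. c k \<otimes> dot t R (b k) y)"
    using insert by (intro finsum_insert[symmetric]) (auto intro!: dot_closed vecs_closed)
  finally show ?case .
qed

text \<open>The map T from coordinates to vectors multiplies the form by d. Pairing with the l-th
  basis vector recovers the l-th coordinate times d, so T is injective. Hence it matches the vectors
  of norm 1 with those of norm d.\<close>

lemma rep_count_orthogonal_basis:
  assumes d: "d \<in> carrier R" "d \<noteq> \<zero>"
    and b: "b \<in> {1..t} \<rightarrow> vecs t R"
    and orth: "\<And>k l. k \<in> {1..t} \<Longrightarrow> l \<in> {1..t} \<Longrightarrow> dot t R (b k) (b l) = (if k = l then d else \<zero>)"
  shows "rep_count t d = rep_count t \<one>"
proof -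
  define T where "T c = (\<lambda>i\<in>{1..t}. \<Oplus>k\<in>{1..t}. c k \<otimes> b k i)" for c :: "nat \<Rightarrow> 'a"
  have dot_T: "dot t R (T c) y = (\<Oplus>k\<in>{1..t}. c k \<otimes> dot t R (b k) y)"
    if "c \<in> vecs t R" "y \<in> vecs t R" for c y
    unfolding T_def by (rule dot_finsum_left) (use that b vecs_closed in auto)
  have T_closed: "T c \<in> vecs t R" if "c \<in> vecs t R" for c
    using that b by (auto simp: T_def vecs_def Pi_iff PiE_iff intro!: finsum_closed)
  have coord: "dot t R (T c) (b l) = c l \<otimes> d" if c: "c \<in> vecs t R" and l: "l \<in> {1..t}" for c l
  proof -
    have ck: "c k \<in> carrier R" if "k \<in> {1..t}" for k using c that by (auto simp: vecs_def)
    have "dot t R (T c) (b l) = (\<Oplus>k\<in>{1..t}. if l = k then c k \<otimes> d else \<zero>)"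
      using c l b by (subst dot_T) (auto intro!: finsum_cong' simp: orth ck d)
    also have "\<dots> = c l \<otimes> d"
      using l ck d by (intro finsum_singleton) auto
    finally show ?thesis .
  qed
  have "inj_on T (vecs t R)"
  proof (rule inj_onI)
    fix c c' assume c: "c \<in> vecs t R" "c' \<in> vecs t R" and eq: "T c = T c'"
    show "c = c'"
    proof (rule vecs_eqI[OF c])
      fix i assume i: "i \<in> {1..t}"
      have "c i \<otimes> d = c' i \<otimes> d" using coord[OF c(1) i] coord[OF c(2) i] eq by simp
      moreover have "c i \<in> carrier R" "c' i \<in> carrier R" using c i by (auto simp: vecs_def)
      ultimately show "c i = c' i" using d m_rcancel by blast
    qed
  qed
  \<comment> \<open>Finiteness replaces a dimension argument: an injective self-map of a finite set
    is onto.\<close>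
  then have bij: "bij_betw T (vecs t R) (vecs t R)"
    using endo_inj_surj[OF finite_vecs, of T] T_closed by (auto simp: bij_betw_def)
  have norm: "dot t R (T c) (T c) = d \<otimes> dot t R c c" if c: "c \<in> vecs t R" for c
  proof -
    have ck: "c k \<in> carrier R" if "k \<in> {1..t}" for k using c that by (auto simp: vecs_def)
    have "dot t R (b k) (T c) = c k \<otimes> d" if "k \<in> {1..t}" for k
      using coord[OF c that] dot_commute[OF vecs_closed vecs_closed, of "b k" t "T c"]
        T_closed[OF c] funcset_mem[OF b that] by auto
    then have "dot t R (T c) (T c) = (\<Oplus>k\<in>{1..t}. d \<otimes> (c k \<otimes> c k))"
      unfolding dot_T[OF c T_closed[OF c]]
      by (intro finsum_cong') (use ck d in \<open>auto simp: m_ac\<close>)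
    also have "\<dots> = d \<otimes> dot t R c c"
      unfolding dot_def by (rule finsum_rdistr[symmetric]) (use ck d in auto)
    finally show ?thesis .
  qed
  have "d \<otimes> u = d \<longleftrightarrow> u = \<one>" if "u \<in> carrier R" for u
    using d that m_lcancel[of d u \<one>] by auto
  then have "bij_betw T {c \<in> vecs t R. dot t R c c = \<one>} {x \<in> vecs t R. dot t R x x = d}"
    by (intro bij_betw_Collect[OF bij]) (simp add: norm dot_closed vecs_closed)
  then show ?thesis unfolding rep_count_def by (rule bij_betw_same_card[symmetric])
qed

section \<open>Sizes of hyperplanes and of their intersections\<close>

lemma card_filter_eq_sum: "finite A \<Longrightarrow> card {x \<in> A. P x} = (\<Sum>x\<in>A. of_bool (P x))"
  by (simp add: Int_def)

lemma dot_upd_Suc_right: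
  assumes "x \<in> {1..Suc t} \<rightarrow> carrier R" "y \<in> vecs t R" "s \<in> carrier R"
  shows "dot (Suc t) R x (y(Suc t := s)) = dot t R x y \<oplus> x (Suc t) \<otimes> s"
proof -
  have "dot (Suc t) R x (y(Suc t := s)) = dot t R x (y(Suc t := s)) \<oplus> x (Suc t) \<otimes> s"
    using assms by (subst dot_Suc) (auto simp: vecs_def Pi_iff PiE_iff)
  also have "dot t R x (y(Suc t := s)) = dot t R x y"
    using assms by (intro dot_cong) (auto simp: Pi_iff vecs_def)
  finally show ?thesis .
qed

text \<open>Induction over the coordinates with a arbitrary, since fixing the last coordinate shifts
  the target. If x is zero on the first t coordinates, exactly one last coordinate is admissible and
  the others are free. The factor q on the left avoids a truncated exponent.\<close>

lemma card_hyperplane: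
  assumes "x \<in> {1..t} \<rightarrow> carrier R" "\<exists>i\<in>{1..t}. x i \<noteq> \<zero>" "a \<in> carrier R"
  shows "q * card {y \<in> vecs t R. dot t R x y = a} = q ^ t"
  using assms
proof (induction t arbitrary: a)
  case 0
  then show ?case by simp
next
  case (Suc t)
  have x: "x (Suc t) \<in> carrier R" "x \<in> {1..t} \<rightarrow> carrier R" using Suc.prems by auto
  have eq: "q * card {y \<in> vecs (Suc t) R. dot (Suc t) R x y = a}
      = (\<Sum>s\<in>carrier R. q * card {y \<in> vecs t R. dot t R x y = a \<ominus> x (Suc t) \<otimes> s})"
    unfolding card_vecs_Suc_filter sum_distrib_left
    by (intro sum.cong arg_cong[where f = "\<lambda>A. q * card A"] Collect_cong conj_cong refl)
       (use Suc.prems x in \<open>simp add: dot_upd_Suc_right add_eq_iff_eq_minus dot_closed vecs_closed\<close>)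
  show ?case
  proof (cases "\<exists>i\<in>{1..t}. x i \<noteq> \<zero>")
    case True
    then show ?thesis unfolding eq using Suc x by (simp add: order_def)
  next
    case False
    then have "x (Suc t) \<noteq> \<zero>" using Suc.prems by (auto simp: le_Suc_eq)
    with x Suc.prems obtain s where s: "s \<in> carrier R"
      "\<And>r. r \<in> carrier R \<Longrightarrow> x (Suc t) \<otimes> r = a \<longleftrightarrow> r = s"
      by (metis unique_linear_solution)
    have zero: "dot t R x y = \<zero>" if "y \<in> vecs t R" for y
      using False that by (auto intro!: dot_zero vecs_closed)
    have "card {y \<in> vecs t R. dot t R x y = a \<ominus> x (Suc t) \<otimes> r} = (if r = s then q ^ t else 0)"
      if r: "r \<in> carrier R" for r
    proof -
      have "\<zero> = a \<ominus> x (Suc t) \<otimes> r \<longleftrightarrow> x (Suc t) \<otimes> r = a"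
        using add_eq_iff_eq_minus[of \<zero> "x (Suc t) \<otimes> r" a] x r Suc.prems by simp
      then have "{y \<in> vecs t R. dot t R x y = a \<ominus> x (Suc t) \<otimes> r} = (if r = s then vecs t R else {})"
        using s(2)[OF r] zero by auto
      then show ?thesis by (simp add: card_vecs)
    qed
    then show ?thesis unfolding eq using s finite_carrier by (simp flip: sum_distrib_left)
  qed
qed

lemma nonzero_vecs_subset: "nonzero_vecs t R \<subseteq> vecs t R"
  by (auto simp: nonzero_vecs_def)

lemma nonzero_vecsD: "x \<in> nonzero_vecs t R \<Longrightarrow> x \<in> vecs t R"
  by (simp add: nonzero_vecs_def)

lemma nonzero_vecs_coordinate:
  assumes "x \<in> nonzero_vecs t R"
  obtains i where "i \<in> {1..t}" "x i \<noteq> \<zero>"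
proof -
  have "x \<in> vecs t R" "x \<noteq> (\<lambda>i\<in>{1..t}. \<zero>)" using assms by (auto simp: nonzero_vecs_def)
  moreover have "(\<lambda>i\<in>{1..t}. \<zero>) \<in> vecs t R" by (auto simp: vecs_def)
  ultimately have "\<exists>i\<in>{1..t}. x i \<noteq> \<zero>" using vecs_eqI[of x t "\<lambda>i\<in>{1..t}. \<zero>"] by auto
  then show ?thesis using that by blast
qed

lemma card_orthogonal:
  assumes "x \<in> nonzero_vecs t R"
  shows "q * card {y \<in> vecs t R. dot t R x y = \<zero>} = q ^ t"
proof (rule card_hyperplane)
  show "x \<in> {1..t} \<rightarrow> carrier R" using assms nonzero_vecs_subset vecs_closed by blast
  show "\<exists>i\<in>{1..t}. x i \<noteq> \<zero>" using assms by (auto elim: nonzero_vecs_coordinate)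
qed simp

text \<open>Double counting of the pairs \<open>(a, y)\<close> such that \<open>y\<close> is orthogonal to \<open>a x + z\<close>.\<close>

lemma card_orthogonal_pair:
  assumes x: "x \<in> nonzero_vecs t R" and z: "z \<in> vecs t R"
    and indep: "\<And>a. a \<in> carrier R \<Longrightarrow> lincomb t a x z \<in> nonzero_vecs t R"
  shows "q ^ 2 * card {y \<in> vecs t R. dot t R x y = \<zero> \<and> dot t R z y = \<zero>} = q ^ t"
proof -
  let ?H = "card {y \<in> vecs t R. dot t R x y = \<zero>}"
  let ?N = "card {y \<in> vecs t R. dot t R x y = \<zero> \<and> dot t R z y = \<zero>}"
  have xv: "x \<in> vecs t R" using x nonzero_vecs_subset by blast
  have cl: "dot t R x y \<in> carrier R" "dot t R z y \<in> carrier R" if "y \<in> vecs t R" for y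
    using that xv z by (auto intro: dot_vecs_closed)
  \<comment> \<open>For fixed y the condition is linear in a with leading coefficient x . y: one
    root if that is nonzero, otherwise all a or none.\<close>
  have count: "card {a \<in> carrier R. dot t R (lincomb t a x z) y = \<zero>}
      = of_bool (dot t R x y \<noteq> \<zero>) + q * of_bool (dot t R x y = \<zero> \<and> dot t R z y = \<zero>)"
    if y: "y \<in> vecs t R" for y
  proof (cases "dot t R x y = \<zero>")
    case True
    then have "{a \<in> carrier R. dot t R (lincomb t a x z) y = \<zero>}
        = (if dot t R z y = \<zero> then carrier R else {})"
      using y xv z cl by (auto simp: dot_lincomb)
    then show ?thesis using True by (simp add: order_def)
  next
    case False
    have "\<ominus> dot t R z y \<in> carrier R" using cl y by simp
    with False cl y obtain s where s: "s \<in> carrier R"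
      "\<And>r. r \<in> carrier R \<Longrightarrow> dot t R x y \<otimes> r = \<ominus> dot t R z y \<longleftrightarrow> r = s"
      by (metis unique_linear_solution)
    have "dot t R (lincomb t a x z) y = \<zero> \<longleftrightarrow> a = s" if a: "a \<in> carrier R" for a
      using a y xv z cl s(2)[OF a]
      by (simp add: dot_lincomb add_eq_iff_eq_minus a_minus_def m_comm)
    then have "{a \<in> carrier R. dot t R (lincomb t a x z) y = \<zero>} = {s}" using s by auto
    then show ?thesis using False by simp
  qed
  \<comment> \<open>Each of the q values of a gives a hyperplane, whose size times q is q^t.\<close>
  have "q * q ^ t = (\<Sum>a\<in>carrier R. q * card {y \<in> vecs t R. dot t R (lincomb t a x z) y = \<zero>})"
    using indep by (simp add: card_orthogonal) (simp add: order_def)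
  also have "\<dots> = q * (\<Sum>a\<in>carrier R. \<Sum>y\<in>vecs t R. of_bool (dot t R (lincomb t a x z) y = \<zero>))"
    by (simp only: card_filter_eq_sum[OF finite_vecs] sum_distrib_left)
  also have "\<dots> = q * (\<Sum>y\<in>vecs t R. \<Sum>a\<in>carrier R. of_bool (dot t R (lincomb t a x z) y = \<zero>))"
    by (simp only: sum.swap[of _ "vecs t R"])
  also have "\<dots> = q * (\<Sum>y\<in>vecs t R. of_bool (dot t R x y \<noteq> \<zero>)
      + q * of_bool (dot t R x y = \<zero> \<and> dot t R z y = \<zero>))"
    by (simp only: card_filter_eq_sum[OF finite_carrier, symmetric] count cong: sum.cong)
  also have "\<dots> = q * (card {y \<in> vecs t R. dot t R x y \<noteq> \<zero>} + q * ?N)"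
    by (simp only: card_filter_eq_sum[OF finite_vecs] sum.distrib sum_distrib_left)
  finally have "q ^ t = card {y \<in> vecs t R. dot t R x y \<noteq> \<zero>} + q * ?N"
    using order_ge_3 by simp
  \<comment> \<open>Splitting the whole space by whether x . y vanishes gives a second expression
    for q^t; comparing the two leaves q N = H.\<close>
  moreover have "q ^ t = card {y \<in> vecs t R. dot t R x y \<noteq> \<zero>} + ?H"
  proof -
    have "vecs t R = {y \<in> vecs t R. dot t R x y \<noteq> \<zero>} \<union> {y \<in> vecs t R. dot t R x y = \<zero>}" by auto
    then have "card (vecs t R)
        = card ({y \<in> vecs t R. dot t R x y \<noteq> \<zero>} \<union> {y \<in> vecs t R. dot t R x y = \<zero>})" by simp
    also have "\<dots> = card {y \<in> vecs t R. dot t R x y \<noteq> \<zero>} + ?H"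
      by (rule card_Un_disjoint) (auto simp: finite_vecs)
    finally show ?thesis by (simp add: card_vecs)
  qed
  ultimately have "q * (q * ?N) = q * ?H" by simp
  then show ?thesis using card_orthogonal[OF x] by (simp add: power2_eq_square mult.assoc)
qed

section \<open>Second moment of the orthogonality relation\<close>

lemma proj_rel_iff_scale:
  "(x, y) \<in> proj_rel t R \<longleftrightarrow> x \<in> nonzero_vecs t R \<and> y \<in> nonzero_vecs t R
    \<and> (\<exists>a\<in>carrier R - {\<zero>}. x = scale t a y)"
  by (auto simp: proj_rel_def scale_def)

lemma scale_nonzero:
  assumes "a \<in> carrier R" "a \<noteq> \<zero>" "x \<in> nonzero_vecs t R"
  shows "scale t a x \<in> nonzero_vecs t R"
proof -
  obtain i where i: "i \<in> {1..t}" "x i \<noteq> \<zero>" using assms nonzero_vecs_coordinate by blast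
  have x: "x \<in> vecs t R" using assms nonzero_vecs_subset by blast
  then have "x i \<in> carrier R" using i by (auto simp: vecs_def)
  then have "a \<otimes> x i \<noteq> \<zero>" using assms i integral by blast
  then have "scale t a x \<noteq> (\<lambda>i\<in>{1..t}. \<zero>)" using i by (auto simp: scale_def dest: fun_cong[of _ _ i])
  then show ?thesis using assms x scale_closed by (auto simp: nonzero_vecs_def)
qed

lemma scale_scale:
  "a \<in> carrier R \<Longrightarrow> b \<in> carrier R \<Longrightarrow> x \<in> vecs t R \<Longrightarrow> scale t a (scale t b x) = scale t (a \<otimes> b) x"
  by (auto simp: scale_def vecs_nth m_assoc intro!: restrict_ext)

lemma scale_one: "x \<in> vecs t R \<Longrightarrow> scale t \<one> x = x"
  by (rule vecs_eqI[OF scale_closed]) (auto simp: scale_def vecs_nth)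

lemma scale_inv:
  assumes "a \<in> carrier R" "a \<noteq> \<zero>" "x \<in> vecs t R"
  shows "scale t (inv a) (scale t a x) = x"
  using assms field_Units by (simp add: scale_scale scale_one)

lemma inv_nonzero: "a \<in> carrier R \<Longrightarrow> a \<noteq> \<zero> \<Longrightarrow> inv a \<in> carrier R - {\<zero>}"
  using field_Units Units_inv_Units by blast

lemma equiv_proj_rel: "equiv (nonzero_vecs t R) (proj_rel t R)"
proof (rule equivI)
  show "proj_rel t R \<subseteq> nonzero_vecs t R \<times> nonzero_vecs t R" by (auto simp: proj_rel_def)
  show "refl_on (nonzero_vecs t R) (proj_rel t R)"
  proof (rule refl_onI)
    fix x assume x: "x \<in> nonzero_vecs t R"
    then have "x = scale t \<one> x" by (intro scale_one[symmetric] nonzero_vecsD)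
    then show "(x, x) \<in> proj_rel t R"
      unfolding proj_rel_iff_scale using x one_closed one_not_zero by blast
  qed
  show "sym (proj_rel t R)"
  proof (rule symI)
    fix x y assume "(x, y) \<in> proj_rel t R"
    then obtain a where a: "a \<in> carrier R" "a \<noteq> \<zero>" "x = scale t a y"
      and xy: "x \<in> nonzero_vecs t R" "y \<in> nonzero_vecs t R"
      by (auto simp: proj_rel_iff_scale)
    then have "y = scale t (inv a) x" using scale_inv[of a y t] nonzero_vecsD by simp
    then show "(y, x) \<in> proj_rel t R"
      using a xy inv_nonzero unfolding proj_rel_iff_scale by blast
  qed
  show "trans (proj_rel t R)"
  proof (rule transI)
    fix x y z assume "(x, y) \<in> proj_rel t R" "(y, z) \<in> proj_rel t R"
    then obtain a b where ab: "a \<in> carrier R - {\<zero>}" "b \<in> carrier R - {\<zero>}"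
      "x = scale t a y" "y = scale t b z"
      and xz: "x \<in> nonzero_vecs t R" "z \<in> nonzero_vecs t R"
      by (auto simp: proj_rel_iff_scale)
    then have "x = scale t (a \<otimes> b) z" using scale_scale[of a b z t] nonzero_vecsD by simp
    moreover have "a \<otimes> b \<in> carrier R - {\<zero>}" using ab integral by auto
    ultimately show "(x, z) \<in> proj_rel t R" using xz unfolding proj_rel_iff_scale by blast
  qed
qed

text \<open>Independence is pairwise only: no two members represent the same projective point, while
  larger subsets may be linearly dependent.\<close>

definition indep_points :: "nat \<Rightarrow> (nat \<Rightarrow> 'a) set \<Rightarrow> bool" where
  "indep_points t X \<longleftrightarrow> X \<subseteq> nonzero_vecs t R \<and> (\<forall>x\<in>X. \<forall>y\<in>X. (x, y) \<in> proj_rel t R \<longrightarrow> x = y)"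

text \<open>Equal multiples force equivalent vectors, hence the same x; a nonzero coordinate then
  cancels to give a = b. This supplies the factor q - 1 between points and vectors.\<close>

lemma inj_on_scale:
  assumes X: "indep_points t X"
  shows "inj_on (\<lambda>(a, x). scale t a x) ((carrier R - {\<zero>}) \<times> X)"
proof -
  have "a = b \<and> x = y"
    if a: "a \<in> carrier R" "a \<noteq> \<zero>" and b: "b \<in> carrier R" "b \<noteq> \<zero>"
      and xy: "x \<in> X" "y \<in> X" and eq: "scale t a x = scale t b y" for a b x y
  proof -
    have nz: "x \<in> nonzero_vecs t R" "y \<in> nonzero_vecs t R" using X xy by (auto simp: indep_points_def)
    then have v: "x \<in> vecs t R" "y \<in> vecs t R" using nonzero_vecs_subset by auto
    have "(scale t a x, x) \<in> proj_rel t R" "(scale t b y, y) \<in> proj_rel t R"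
      using a b nz scale_nonzero unfolding proj_rel_iff_scale by blast+
    then have "(x, y) \<in> proj_rel t R"
      using eq equiv_proj_rel[of t] by (metis equivE symE transE)
    then have "x = y" using X xy by (auto simp: indep_points_def)
    obtain i where i: "i \<in> {1..t}" "x i \<noteq> \<zero>" using nz nonzero_vecs_coordinate by blast
    have "x i \<in> carrier R" using i v by (auto simp: vecs_def)
    moreover have "a \<otimes> x i = b \<otimes> x i"
      using fun_cong[OF eq, of i] i \<open>x = y\<close> by (simp add: scale_def)
    ultimately have "a = b" using a b i m_rcancel by blast
    then show "a = b \<and> x = y" using \<open>x = y\<close> by simp
  qed
  then show ?thesis by (auto intro!: inj_onI)
qed

section \<open>Orthogonality indicators with their mean removed\<close>

definition centered :: "nat \<Rightarrow> (nat \<Rightarrow> 'a) \<Rightarrow> (nat \<Rightarrow> 'a) \<Rightarrow> real" where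
  "centered t x y = of_bool (dot t R x y = \<zero>) - 1 / real q"

text \<open>If a x + z vanished, z would be -a times x; the factor is nonzero because z is, so z and
  x would be the same point.\<close>

lemma lincomb_nonzero:
  assumes x: "x \<in> nonzero_vecs t R" and z: "z \<in> nonzero_vecs t R"
    and "(z, x) \<notin> proj_rel t R" and a: "a \<in> carrier R"
  shows "lincomb t a x z \<in> nonzero_vecs t R"
proof (rule ccontr)
  assume *: "lincomb t a x z \<notin> nonzero_vecs t R"
  have v: "x \<in> vecs t R" "z \<in> vecs t R" using x z nonzero_vecs_subset by auto
  then have "lincomb t a x z = (\<lambda>i\<in>{1..t}. \<zero>)"
    using * lincomb_closed[OF a v] by (auto simp: nonzero_vecs_def)
  then have eq: "a \<otimes> x i \<oplus> z i = \<zero>" if "i \<in> {1..t}" for i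
    using that by (auto simp: lincomb_def dest: fun_cong[of _ _ i])
  have zi: "z i = \<ominus> a \<otimes> x i" if i: "i \<in> {1..t}" for i
  proof -
    have c: "x i \<in> carrier R" "z i \<in> carrier R" using i v by (auto simp: vecs_def)
    then have "\<ominus> z i = a \<otimes> x i" using eq[OF i] a by (intro minus_equality) auto
    then show ?thesis using a c by (metis l_minus minus_minus)
  qed
  have "z = scale t (\<ominus> a) x"
    by (rule vecs_eqI[OF v(2) scale_closed[OF _ v(1)]]) (use a zi in \<open>auto simp: scale_def\<close>)
  moreover have "\<ominus> a \<noteq> \<zero>"
  proof
    assume 0: "\<ominus> a = \<zero>"
    obtain i where i: "i \<in> {1..t}" "z i \<noteq> \<zero>" using z nonzero_vecs_coordinate by blast
    then have "x i \<in> carrier R" using v by (auto simp: vecs_def)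
    then show False using zi[OF i(1)] i 0 by simp
  qed
  ultimately have "(z, x) \<in> proj_rel t R" using x z a unfolding proj_rel_iff_scale by blast
  with assms show False by blast
qed

text \<open>A hyperplane has density 1/q, so \<open>centered\<close> has mean zero. Distinct
  hyperplanes meet in density 1/q^2, the product of their densities, whence the covariance vanishes;
  the diagonal value is q^t times the variance of an indicator of mean 1/q.\<close>

lemma sum_centered_mult:
  assumes X: "indep_points t X" and xz: "x \<in> X" "z \<in> X"
  shows "(\<Sum>y\<in>vecs t R. centered t x y * centered t z y)
    = of_bool (x = z) * (real q ^ t * (1 / real q - 1 / real q ^ 2))"
proof -
  let ?H = "\<lambda>x. real (card {y \<in> vecs t R. dot t R x y = \<zero>})"
  let ?N = "real (card {y \<in> vecs t R. dot t R x y = \<zero> \<and> dot t R z y = \<zero>})"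
  have q: "real q > 0" using order_ge_3 by simp
  have nz: "x \<in> nonzero_vecs t R" "z \<in> nonzero_vecs t R" using X xz by (auto simp: indep_points_def)
  have H: "?H w = real q ^ t / real q" if "w \<in> nonzero_vecs t R" for w
  proof -
    have "real q * ?H w = real q ^ t" using card_orthogonal[OF that] by (metis of_nat_mult of_nat_power)
    then show ?thesis using q by (simp add: eq_divide_eq mult.commute)
  qed
  have N: "?N = (if x = z then real q ^ t / real q else real q ^ t / real q ^ 2)"
  proof (cases "x = z")
    case False
    then have "(z, x) \<notin> proj_rel t R" using X xz by (auto simp: indep_points_def)
    then have "q ^ 2 * card {y \<in> vecs t R. dot t R x y = \<zero> \<and> dot t R z y = \<zero>} = q ^ t"
      using nz nonzero_vecs_subset by (intro card_orthogonal_pair lincomb_nonzero) auto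
    from arg_cong[OF this, of real] have "real q ^ 2 * ?N = real q ^ t" by simp
    then show ?thesis using False q by (simp add: eq_divide_eq mult.commute)
  qed (use H[OF nz(1)] in simp)
  have of_bool_sum: "(\<Sum>y\<in>vecs t R. of_bool (P y)) = real (card {y \<in> vecs t R. P y})" for P
    using finite_vecs by (simp add: Int_def)
  have "(\<Sum>y\<in>vecs t R. centered t x y * centered t z y)
      = (\<Sum>y\<in>vecs t R. of_bool (dot t R x y = \<zero> \<and> dot t R z y = \<zero>)
          - of_bool (dot t R x y = \<zero>) / real q - of_bool (dot t R z y = \<zero>) / real q
          + 1 / real q ^ 2)"
    by (intro sum.cong) (auto simp: centered_def algebra_simps power2_eq_square diff_divide_distrib)
  also have "\<dots> = ?N - ?H x / real q - ?H z / real q + real q ^ t / real q ^ 2"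
    by (simp only: sum.distrib sum_subtractf of_bool_sum flip: sum_divide_distrib)
       (simp add: card_vecs)
  also have "\<dots> = of_bool (x = z) * (real q ^ t * (1 / real q - 1 / real q ^ 2))"
    unfolding H[OF nz(1)] H[OF nz(2)] N using q by (auto simp: field_simps power2_eq_square)
  finally show ?thesis .
qed

text \<open>Pythagoras: when the square is expanded, only the diagonal pairs survive.\<close>

lemma second_moment:
  assumes X: "indep_points t X" and "finite X"
  shows "(\<Sum>y\<in>vecs t R. (\<Sum>x\<in>X. centered t x y)\<^sup>2)
    = real (card X) * (real q ^ t * (1 / real q - 1 / real q ^ 2))"
proof -
  have "(\<Sum>y\<in>vecs t R. (\<Sum>x\<in>X. centered t x y)\<^sup>2)
      = (\<Sum>y\<in>vecs t R. \<Sum>x\<in>X. \<Sum>z\<in>X. centered t x y * centered t z y)"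
    by (simp add: power2_eq_square sum_product)
  also have "\<dots> = (\<Sum>x\<in>X. \<Sum>y\<in>vecs t R. \<Sum>z\<in>X. centered t x y * centered t z y)"
    by (rule sum.swap)
  also have "\<dots> = (\<Sum>x\<in>X. \<Sum>z\<in>X. \<Sum>y\<in>vecs t R. centered t x y * centered t z y)"
    by (intro sum.cong refl sum.swap)
  also have "\<dots> = (\<Sum>x\<in>X. \<Sum>z\<in>X. if x = z then real q ^ t * (1 / real q - 1 / real q ^ 2) else 0)"
    by (intro sum.cong refl) (simp add: sum_centered_mult[OF X])
  also have "\<dots> = real (card X) * (real q ^ t * (1 / real q - 1 / real q ^ 2))"
    using \<open>finite X\<close> by simp
  finally show ?thesis .
qed

lemma centered_scale:
  assumes "a \<in> carrier R" "a \<noteq> \<zero>" "x \<in> vecs t R" "y \<in> vecs t R"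
  shows "centered t x (scale t a y) = centered t x y"
proof -
  have "a \<otimes> dot t R x y = \<zero> \<longleftrightarrow> dot t R x y = \<zero>"
    using assms integral[of a "dot t R x y"] dot_vecs_closed by auto
  then show ?thesis using assms by (simp add: centered_def dot_scale_right)
qed

text \<open>The inner sum is constant along each projective point, so its squares over Y are
  repeated q - 1 times among the vectors. Spreading Y over all its nonzero multiples before applying
  \<open>second_moment\<close> cancels the factor q - 1 on the right; Cauchy-Schwarz over Y
  finishes.\<close>

lemma discrepancy_bound:
  assumes X: "indep_points t X" and Y: "indep_points t Y" and fin: "finite X" "finite Y"
    and t: "t \<ge> 2"
  shows "\<bar>\<Sum>y\<in>Y. \<Sum>x\<in>X. centered t x y\<bar>
    \<le> sqrt (real q ^ (t - 2)) * sqrt (real (card X) * real (card Y))"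
proof -
  let ?f = "\<lambda>y. \<Sum>x\<in>X. centered t x y"
  let ?U = "carrier R - {\<zero>}"
  have q: "real q > 1" using order_ge_3 by simp
  have sub: "X \<subseteq> vecs t R" "Y \<subseteq> vecs t R"
    using X Y nonzero_vecs_subset unfolding indep_points_def by blast+
  have cardU: "real (card ?U) = real q - 1"
    using finite_carrier order_ge_3 by (simp add: order_def of_nat_diff)
  \<comment> \<open>As t is at least 2 the subtraction is exact, and q^t (1/q - 1/q^2) becomes (q -
    1) q^(t - 2).\<close>
  have qt: "real q ^ t = real q ^ (t - 2) * real q ^ 2"
    using t by (metis le_add_diff_inverse2 power_add)
  have "(real q - 1) * (\<Sum>y\<in>Y. (?f y)\<^sup>2) = (\<Sum>a\<in>?U. \<Sum>y\<in>Y. (?f y)\<^sup>2)"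
    by (simp only: sum_constant cardU)
  also have "\<dots> = (\<Sum>a\<in>?U. \<Sum>y\<in>Y. (?f (scale t a y))\<^sup>2)"
    using sub by (intro sum.cong refl arg_cong[where f = "\<lambda>r. r\<^sup>2"])
      (auto simp: centered_scale subset_iff)
  also have "\<dots> = (\<Sum>z\<in>?U \<times> Y. (?f ((\<lambda>(a, y). scale t a y) z))\<^sup>2)"
    by (simp add: sum.cartesian_product case_prod_unfold)
  also have "\<dots> = (\<Sum>y\<in>(\<lambda>(a, y). scale t a y) ` (?U \<times> Y). (?f y)\<^sup>2)"
    by (rule sum.reindex_cong[OF inj_on_scale[OF Y], symmetric]) auto
  also have "\<dots> \<le> (\<Sum>y\<in>vecs t R. (?f y)\<^sup>2)"
    using sub by (intro sum_mono2 finite_vecs) (auto intro!: scale_closed)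
  also have "\<dots> = (real q - 1) * (real (card X) * real q ^ (t - 2))"
    unfolding second_moment[OF X fin(1)] qt using q by (simp add: field_simps power2_eq_square)
  finally have bound: "(\<Sum>y\<in>Y. (?f y)\<^sup>2) \<le> real (card X) * real q ^ (t - 2)"
    using q by simp
  have "(\<Sum>y\<in>Y. ?f y)\<^sup>2 \<le> (\<Sum>y\<in>Y. (?f y)\<^sup>2) * real (card Y)"
    using sum_squared_le_sum_of_squares[of ?f Y] by simp
  also have "\<dots> \<le> real q ^ (t - 2) * (real (card X) * real (card Y))"
    using mult_right_mono[OF bound, of "real (card Y)"] by (simp add: mult_ac)
  finally have "sqrt ((\<Sum>y\<in>Y. ?f y)\<^sup>2) \<le> sqrt (real q ^ (t - 2) * (real (card X) * real (card Y)))"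
    by (rule real_sqrt_le_mono)
  then show ?thesis by (simp only: real_sqrt_abs real_sqrt_mult)
qed

end

section \<open>The graph on the non-square points\<close>

text \<open>Ordered pairs are fibred over their edges. The swapped pair is also admissible exactly
  when both ends lie in the intersection of X and Y, which is what the second summand of
  \<open>edge_count\<close> counts.\<close>

lemma edge_count_eq_card_pairs:
  assumes sym: "\<And>u v. E u v \<Longrightarrow> E v u" and irrefl: "\<And>u. u \<in> V \<Longrightarrow> \<not> E u u"
    and G: "edges G = {{u, v} | u v. u \<in> V \<and> v \<in> V \<and> E u v}"
    and X: "X \<subseteq> V" "finite X" and Y: "Y \<subseteq> V" "finite Y"
  shows "edge_count G X Y = card {(x, y) \<in> X \<times> Y. E x y}"
proof -
  let ?S = "{(x, y) \<in> X \<times> Y. E x y}" and ?h = "\<lambda>(x, y). {x, y}"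
  have finS: "finite ?S" by (rule finite_subset[OF _ finite_cartesian_product[OF X(2) Y(2)]]) auto
  have E1: "{e \<in> edges G. \<exists>x\<in>X. \<exists>y\<in>Y. e = {x, y}} = ?h ` ?S"
  proof (intro equalityI subsetI)
    fix e assume "e \<in> {e \<in> edges G. \<exists>x\<in>X. \<exists>y\<in>Y. e = {x, y}}"
    then obtain x y where e: "x \<in> X" "y \<in> Y" "e = {x, y}" "e \<in> edges G" by blast
    then obtain u v where uv: "{x, y} = {u, v}" "E u v" unfolding G by blast
    have "E x y" using uv(1) uv(2) sym[OF uv(2)] by (auto simp only: doubleton_eq_iff)
    with e show "e \<in> ?h ` ?S" by force
  next
    fix e assume "e \<in> ?h ` ?S"
    then obtain x y where e: "x \<in> X" "y \<in> Y" "E x y" "e = {x, y}" by auto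
    then have "e \<in> edges G" unfolding G using X Y by blast
    with e show "e \<in> {e \<in> edges G. \<exists>x\<in>X. \<exists>y\<in>Y. e = {x, y}}" by blast
  qed
  \<comment> \<open>An edge inside the intersection also joins X to Y, so both summands range over
    the same image.\<close>
  have E2: "{e \<in> edges G. e \<subseteq> X \<inter> Y} = {e \<in> ?h ` ?S. e \<subseteq> X \<inter> Y}"
    unfolding E1[symmetric]
  proof (intro equalityI subsetI)
    fix e assume e: "e \<in> {e \<in> edges G. e \<subseteq> X \<inter> Y}"
    then obtain u v where "e = {u, v}" unfolding G by blast
    with e show "e \<in> {e \<in> {e \<in> edges G. \<exists>x\<in>X. \<exists>y\<in>Y. e = {x, y}}. e \<subseteq> X \<inter> Y}" by blast
  qed blast
  have fibre: "card {z \<in> ?S. ?h z = e} = 1 + of_bool (e \<subseteq> X \<inter> Y)" if e: "e \<in> ?h ` ?S" for e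
  proof -
    obtain x y where xy: "x \<in> X" "y \<in> Y" "E x y" "e = {x, y}" using e by auto
    then have "x \<noteq> y" using irrefl X by blast
    have "z \<in> ?S \<and> ?h z = e \<longleftrightarrow> z = (x, y) \<or> z = (y, x) \<and> e \<subseteq> X \<inter> Y" for z
      using xy(1-3) sym[OF xy(3)] unfolding xy(4)
      by (cases z) (simp add: doubleton_eq_iff, blast)
    then have "{z \<in> ?S. ?h z = e} = (if e \<subseteq> X \<inter> Y then {(x, y), (y, x)} else {(x, y)})"
      by (cases "e \<subseteq> X \<inter> Y") (simp_all only: set_eq_iff mem_Collect_eq insert_iff empty_iff
        if_True if_False simp_thms)
    then show ?thesis using \<open>x \<noteq> y\<close> by simp
  qed
  have "card ?S = (\<Sum>e\<in>?h ` ?S. \<Sum>z\<in>{z \<in> ?S. ?h z = e}. 1)"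
    unfolding card_eq_sum[of ?S] by (rule sum.group[symmetric]) (use finS in auto)
  also have "\<dots> = (\<Sum>e\<in>?h ` ?S. 1 + of_bool (e \<subseteq> X \<inter> Y))"
    unfolding card_eq_sum[symmetric] by (rule sum.cong[OF refl fibre])
  also have "\<dots> = card (?h ` ?S) + card {e \<in> ?h ` ?S. e \<subseteq> X \<inter> Y}"
    using finS by (simp add: sum.distrib Int_def)
  finally show ?thesis unfolding edge_count_def E1 E2 by simp
qed

context odd_field
begin

section \<open>Non-square points and chosen representatives\<close>

lemma nonsquare_vec_iff: "nonsquare_vec t R x \<longleftrightarrow> quad_char (dot t R x x) = -1"
  unfolding nonsquare_vec_def quad_char_eq_m1_iff
  by (auto simp: numeral_2_eq_2)

lemma nonsquare_vecs_subset: "nonsquare_vecs t R \<subseteq> nonzero_vecs t R"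
proof
  fix x assume x: "x \<in> nonsquare_vecs t R"
  then have v: "x \<in> vecs t R" and "quad_char (dot t R x x) = -1"
    by (auto simp: nonsquare_vecs_def nonsquare_vec_iff)
  moreover have "dot t R (\<lambda>i\<in>{1..t}. \<zero>) (\<lambda>i\<in>{1..t}. \<zero>) = \<zero>"
    by (rule dot_zero) auto
  ultimately show "x \<in> nonzero_vecs t R" by (auto simp: nonzero_vecs_def)
qed

lemma scale_nonsquare:
  assumes "a \<in> carrier R" "a \<noteq> \<zero>" "x \<in> nonsquare_vecs t R"
  shows "scale t a x \<in> nonsquare_vecs t R"
proof -
  have x: "x \<in> vecs t R" "quad_char (dot t R x x) = -1"
    using assms by (auto simp: nonsquare_vecs_def nonsquare_vec_iff)
  then have "dot t R (scale t a x) (scale t a x) = a \<otimes> a \<otimes> dot t R x x"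
    using assms by (simp add: dot_scale_left dot_scale_right scale_closed dot_vecs_closed m_assoc)
  then show ?thesis
    using assms x by (simp add: nonsquare_vecs_def nonsquare_vec_iff scale_closed
        quad_char_square_mult dot_vecs_closed)
qed

text \<open>Any choice will do, since orthogonality and non-squareness are invariant under nonzero
  scaling.\<close>

definition rep :: "(nat \<Rightarrow> 'a) set \<Rightarrow> nat \<Rightarrow> 'a" where
  "rep P = (SOME x. x \<in> P)"

lemma nonsquare_point_rep:
  assumes "P \<in> nonsquare_points t R"
  shows "rep P \<in> P" "rep P \<in> nonsquare_vecs t R" "P = proj_rel t R `` {rep P}"
proof -
  obtain x where x: "x \<in> nonsquare_vecs t R" "P = proj_rel t R `` {x}"
    using assms by (auto simp: nonsquare_points_def quotient_def)
  then have nz: "x \<in> nonzero_vecs t R" using nonsquare_vecs_subset by blast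
  then have "x \<in> P" using x equiv_class_self[OF equiv_proj_rel] by simp
  then show repP: "rep P \<in> P" unfolding rep_def by (rule someI[of "\<lambda>x. x \<in> P"])
  then have "(x, rep P) \<in> proj_rel t R" using x by simp
  from x(2) equiv_class_eq[OF equiv_proj_rel this] show "P = proj_rel t R `` {rep P}"
    by (rule trans)
  have "(rep P, x) \<in> proj_rel t R"
    using \<open>(x, rep P) \<in> proj_rel t R\<close> equiv_proj_rel[of t] by (metis equivE symE)
  then obtain a where "a \<in> carrier R" "a \<noteq> \<zero>" "rep P = scale t a x"
    by (auto simp: proj_rel_iff_scale)
  then show "rep P \<in> nonsquare_vecs t R" using x scale_nonsquare[of a x t] by simp
qed

lemma rep_closed: "P \<in> nonsquare_points t R \<Longrightarrow> rep P \<in> vecs t R"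
  using nonsquare_point_rep(2) by (auto simp: nonsquare_vecs_def)

lemma nonsquare_point_elem:
  assumes "P \<in> nonsquare_points t R" "x \<in> P"
  obtains a where "a \<in> carrier R" "a \<noteq> \<zero>" "x = scale t a (rep P)"
proof -
  have "(rep P, x) \<in> proj_rel t R" using nonsquare_point_rep(3)[OF assms(1)] assms(2) by blast
  then have "(x, rep P) \<in> proj_rel t R" using equiv_proj_rel[of t] by (metis equivE symE)
  then show ?thesis using that by (auto simp: proj_rel_iff_scale)
qed

lemma inj_on_rep: "inj_on rep (nonsquare_points t R)"
  using nonsquare_point_rep(3) by (metis inj_onI)

lemma indep_points_rep:
  assumes "X \<subseteq> nonsquare_points t R"
  shows "indep_points t (rep ` X)"
  unfolding indep_points_def
proof (intro conjI ballI impI)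
  show "rep ` X \<subseteq> nonzero_vecs t R"
    using assms nonsquare_point_rep(2) nonsquare_vecs_subset by fast
  fix x y assume "x \<in> rep ` X" "y \<in> rep ` X" and rel: "(x, y) \<in> proj_rel t R"
  then obtain P Q where PQ: "P \<in> X" "Q \<in> X" "x = rep P" "y = rep Q" by blast
  then have "proj_rel t R `` {rep P} = proj_rel t R `` {rep Q}"
    using rel equiv_class_eq[OF equiv_proj_rel] by blast
  then show "x = y" using PQ assms nonsquare_point_rep(3) by (metis subsetD)
qed

lemma finite_nonsquare_points: "finite (nonsquare_points t R)"
proof -
  have "finite (nonsquare_vecs t R)"
    by (rule finite_subset[OF _ finite_vecs]) (auto simp: nonsquare_vecs_def)
  then show ?thesis unfolding nonsquare_points_def quotient_def by simp
qed

lemma card_nonsquare_vecs: "card (nonsquare_vecs t R) = (q - 1) * card (nonsquare_points t R)"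
proof -
  let ?U = "carrier R - {\<zero>}" and ?P = "nonsquare_points t R"
  have "nonsquare_vecs t R = (\<lambda>(a, x). scale t a x) ` (?U \<times> rep ` ?P)"
  proof (intro equalityI subsetI)
    fix x assume x: "x \<in> nonsquare_vecs t R"
    let ?C = "proj_rel t R `` {x}"
    have C: "?C \<in> ?P" using x by (auto simp: nonsquare_points_def quotient_def)
    have "x \<in> ?C"
      using x nonsquare_vecs_subset equiv_class_self[OF equiv_proj_rel] by blast
    then obtain a where "a \<in> carrier R" "a \<noteq> \<zero>" "x = scale t a (rep ?C)"
      using nonsquare_point_elem[OF C] by blast
    then show "x \<in> (\<lambda>(a, x). scale t a x) ` (?U \<times> rep ` ?P)" using C by force
  qed (auto intro: scale_nonsquare nonsquare_point_rep(2))
  then have "card (nonsquare_vecs t R) = card (?U \<times> rep ` ?P)"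
    by (simp add: card_image[OF inj_on_scale[OF indep_points_rep[OF subset_refl]]])
  also have "\<dots> = (q - 1) * card ?P"
    using finite_carrier by (simp add: card_cartesian_product card_image[OF inj_on_rep] order_def)
  finally show ?thesis .
qed

lemma uminus_one_nonzero: "\<ominus> \<one> \<noteq> \<zero>"
  by (metis minus_minus minus_zero one_closed one_not_zero)

text \<open>There are (q - 1)/2 non-square norms, each attained equally often by
  \<open>rep_count_odd\<close>; each point accounts for q - 1 vectors. The sign is left open because
  the size estimate treats both cases.\<close>

lemma card_nonsquare_points:
  "\<exists>e\<in>{1, -1 :: int}. 2 * int (card (nonsquare_points (2 * m + 1) R)) = int q ^ (2 * m) + e * int q ^ m"
proof -
  let ?t = "2 * m + 1" and ?N = "{c \<in> carrier R. quad_char c = -1}"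
  define e where "e = quad_char (\<ominus> \<one>) ^ m"
  have "quad_char (\<ominus> \<one>) = 1 \<or> quad_char (\<ominus> \<one>) = -1"
    by (rule quad_char_nonzero[OF uminus_one_nonzero])
  then have e: "- e \<in> {1, -1}" by (cases "even m") (auto simp: e_def)
  have finN: "finite ?N" using finite_carrier by simp
  have "card (nonsquare_vecs ?t R) = (\<Sum>x\<in>nonsquare_vecs ?t R. 1)" by simp
  also have "\<dots> = (\<Sum>c\<in>?N. \<Sum>x\<in>{x \<in> nonsquare_vecs ?t R. dot ?t R x x = c}. 1)"
    by (rule sum.group[symmetric], rule finite_subset[OF _ finite_vecs])
       (auto simp: nonsquare_vecs_def nonsquare_vec_iff finite_carrier dot_vecs_closed)
  also have "\<dots> = (\<Sum>c\<in>?N. rep_count ?t c)"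
    unfolding rep_count_def card_eq_sum
    by (intro sum.cong refl) (auto simp: nonsquare_vecs_def nonsquare_vec_iff)
  finally have "int (card (nonsquare_vecs ?t R)) = (\<Sum>c\<in>?N. int (rep_count ?t c))" by simp
  also have "\<dots> = (\<Sum>c\<in>?N. int q ^ (2 * m) - e * int q ^ m)"
    by (intro sum.cong refl) (auto simp: rep_count_odd e_def power_mult_distrib)
  also have "\<dots> = int (card ?N) * (int q ^ (2 * m) - e * int q ^ m)" by simp
  finally have "2 * int (card (nonsquare_vecs ?t R))
      = int (2 * card ?N) * (int q ^ (2 * m) - e * int q ^ m)" by simp
  then have "int (q - 1) * (2 * int (card (nonsquare_points ?t R)))
      = int (q - 1) * (int q ^ (2 * m) - e * int q ^ m)"
    unfolding card_quad_char card_nonsquare_vecs by simp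
  moreover have "int (q - 1) \<noteq> 0" using order_ge_3 by simp
  ultimately have "2 * int (card (nonsquare_points ?t R)) = int q ^ (2 * m) - e * int q ^ m"
    using mult_left_cancel by blast
  \<comment> \<open>The sign flips because \<chi> is -1 on the norms being summed over.\<close>
  with e show ?thesis by (intro bexI[of _ "- e"]) auto
qed

section \<open>The induced subgraph and its edge counts\<close>

abbreviation orth :: "nat \<Rightarrow> (nat \<Rightarrow> 'a) set \<Rightarrow> (nat \<Rightarrow> 'a) set \<Rightarrow> bool" where
  "orth t P Q \<equiv> dot t R (rep P) (rep Q) = \<zero>"

text \<open>Other elements of the two points differ from the representatives by nonzero factors,
  which cancel in the equation.\<close>

lemma orth_iff:
  assumes P: "P \<in> nonsquare_points t R" and Q: "Q \<in> nonsquare_points t R"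
  shows "(\<exists>x\<in>P. \<exists>y\<in>Q. dot t R x y = \<zero>) \<longleftrightarrow> orth t P Q"
proof
  assume "\<exists>x\<in>P. \<exists>y\<in>Q. dot t R x y = \<zero>"
  then obtain x y where xy: "x \<in> P" "y \<in> Q" "dot t R x y = \<zero>" by blast
  obtain a b where a: "a \<in> carrier R" "a \<noteq> \<zero>" "x = scale t a (rep P)"
    and b: "b \<in> carrier R" "b \<noteq> \<zero>" "y = scale t b (rep Q)"
    using nonsquare_point_elem xy P Q by metis
  have v: "rep P \<in> vecs t R" "rep Q \<in> vecs t R" using P Q rep_closed by auto
  then have "a \<otimes> (b \<otimes> dot t R (rep P) (rep Q)) = \<zero>"
    using xy(3) a b by (simp add: dot_scale_left dot_scale_right scale_closed dot_vecs_closed m_lcomm)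
  then show "orth t P Q" using a b v dot_vecs_closed integral m_closed by metis
qed (use P Q nonsquare_point_rep(1) in blast)

lemma orth_commute:
  "P \<in> nonsquare_points t R \<Longrightarrow> Q \<in> nonsquare_points t R \<Longrightarrow> orth t P Q \<longleftrightarrow> orth t Q P"
  using dot_commute[OF vecs_closed[OF rep_closed] vecs_closed[OF rep_closed]] by metis

lemma rep_norm: "P \<in> nonsquare_points t R \<Longrightarrow> quad_char (dot t R (rep P) (rep P)) = -1"
  using nonsquare_point_rep(2)[of P t] by (auto simp: nonsquare_vecs_def nonsquare_vec_iff)

lemma not_orth_self: "P \<in> nonsquare_points t R \<Longrightarrow> \<not> orth t P P"
  using rep_norm by fastforce

lemma nonsquare_points_verts: "nonsquare_points t R \<subseteq> verts (AK t R)"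
proof
  fix P assume P: "P \<in> nonsquare_points t R"
  have "P \<in> proj_points t R"
    using P nonsquare_vecs_subset[of t] by (auto simp: nonsquare_points_def proj_points_def quotient_def)
  moreover have "rep P \<in> P" "\<not> absolute_vec t R (rep P)"
    using nonsquare_point_rep(1)[OF P] not_orth_self[OF P] by (auto simp: absolute_vec_def)
  ultimately show "P \<in> verts (AK t R)" by (auto simp: AK_def Let_def)
qed

abbreviation nonsquare_graph :: "nat \<Rightarrow> (nat \<Rightarrow> 'a) set graph" where
  "nonsquare_graph t \<equiv> induced (AK t R) (nonsquare_points t R)"

lemma verts_nonsquare_graph: "verts (nonsquare_graph t) = nonsquare_points t R"
  unfolding induced_def fst_conv by (rule Int_absorb1[OF nonsquare_points_verts])

text \<open>Distinctness of the ends can be omitted, as a non-square point is not orthogonal to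
  itself; the result has the form that \<open>edge_count_eq_card_pairs\<close> expects.\<close>

lemma edges_nonsquare_graph:
  "edges (nonsquare_graph t) = {{P, Q} | P Q. P \<in> nonsquare_points t R \<and> Q \<in> nonsquare_points t R \<and>
    orth t P Q}" (is "_ = ?E")
proof (intro equalityI subsetI)
  fix e assume "e \<in> edges (nonsquare_graph t)"
  then have e: "e \<in> edges (AK t R)" "e \<subseteq> nonsquare_points t R"
    unfolding induced_def snd_conv by blast+
  then obtain P Q where PQ: "e = {P, Q}" "\<exists>x\<in>P. \<exists>y\<in>Q. dot t R x y = \<zero>"
    unfolding AK_def Let_def snd_conv by blast
  have V: "P \<in> nonsquare_points t R" "Q \<in> nonsquare_points t R" using e PQ(1) by auto
  with PQ(1) orth_iff[THEN iffD1, OF V PQ(2)] show "e \<in> ?E" by blast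
next
  fix e assume "e \<in> ?E"
  then obtain P Q where PQ: "e = {P, Q}" "P \<in> nonsquare_points t R" "Q \<in> nonsquare_points t R"
    "orth t P Q" by blast
  have ne: "P \<noteq> Q" using PQ(2,4) not_orth_self by blast
  have ex: "\<exists>x\<in>P. \<exists>y\<in>Q. dot t R x y = \<zero>" by (rule orth_iff[THEN iffD2, OF PQ(2-4)])
  have "P \<in> verts (AK t R)" "Q \<in> verts (AK t R)" using PQ nonsquare_points_verts by blast+
  with PQ(1) ne ex have "e \<in> edges (AK t R)"
    unfolding AK_def Let_def fst_conv snd_conv by blast
  with PQ show "e \<in> edges (nonsquare_graph t)" unfolding induced_def snd_conv by blast
qed

lemma edge_count_discrepancy:
  assumes X: "X \<subseteq> nonsquare_points t R" and Y: "Y \<subseteq> nonsquare_points t R" and t: "t \<ge> 2"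
  shows "\<bar>real (edge_count (nonsquare_graph t) X Y) - 1 / real q * real (card X) * real (card Y)\<bar>
    \<le> sqrt (real q ^ (t - 2)) * sqrt (real (card X) * real (card Y))"
proof -
  have fin: "finite X" "finite Y" using X Y finite_nonsquare_points finite_subset by blast+
  have inj: "inj_on rep X" "inj_on rep Y" using X Y inj_on_rep inj_on_subset by blast+
  let ?V = "nonsquare_points t R"
  \<comment> \<open>Membership in \<open>?V\<close> is made part of the relation so that its
    symmetry holds for arbitrary arguments.\<close>
  have "edge_count (nonsquare_graph t) X Y
      = card {(P, Q) \<in> X \<times> Y. P \<in> ?V \<and> Q \<in> ?V \<and> orth t P Q}"
    by (rule edge_count_eq_card_pairs[where V = ?V])
       (use X Y fin orth_commute not_orth_self in \<open>auto simp: edges_nonsquare_graph\<close>)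
  also have "{(P, Q) \<in> X \<times> Y. P \<in> ?V \<and> Q \<in> ?V \<and> orth t P Q}
      = (SIGMA P:X. {Q \<in> Y. orth t P Q})" using X Y by auto
  also have "card \<dots> = (\<Sum>P\<in>X. card {Q \<in> Y. orth t P Q})" using fin by simp
  finally have "real (edge_count (nonsquare_graph t) X Y) = (\<Sum>P\<in>X. \<Sum>Q\<in>Y. of_bool (orth t P Q))"
    using fin by (simp add: Int_def)
  then have "real (edge_count (nonsquare_graph t) X Y) - 1 / real q * real (card X) * real (card Y)
      = (\<Sum>P\<in>X. \<Sum>Q\<in>Y. centered t (rep P) (rep Q))"
    by (simp add: centered_def sum_subtractf)
  also have "\<dots> = (\<Sum>Q\<in>Y. \<Sum>P\<in>X. centered t (rep P) (rep Q))" by (rule sum.swap)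
  also have "\<dots> = (\<Sum>y\<in>rep ` Y. \<Sum>x\<in>rep ` X. centered t x y)"
    using inj by (simp add: sum.reindex)
  finally show ?thesis
    using discrepancy_bound[OF indep_points_rep[OF X] indep_points_rep[OF Y], of] fin t inj
    by (simp add: card_image)
qed

section \<open>Absence of cliques of size t\<close>

lemma nonsquare_ratio_square:
  assumes "c \<in> carrier R" "d \<in> carrier R" "quad_char c = -1" "quad_char d = -1"
  obtains s where "s \<in> carrier R" "s \<otimes> (s \<otimes> c) = d"
proof -
  have "c \<noteq> \<zero>" using assms by auto
  then have i: "inv c \<in> carrier R" "inv c \<otimes> c = \<one>" "c \<otimes> inv c = \<one>"
    using assms field_Units by auto
  \<comment> \<open>Two non-squares multiply to a square w w; then s = w / c satisfies s s c =
    d.\<close>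
  have "quad_char (d \<otimes> c) = 1" using assms by (simp add: quad_char_mult)
  then obtain w where w: "w \<in> carrier R" "w \<otimes> w = d \<otimes> c" by (auto simp: quad_char_eq_1_iff)
  have "(w \<otimes> inv c) \<otimes> ((w \<otimes> inv c) \<otimes> c) = (w \<otimes> w) \<otimes> inv c \<otimes> (inv c \<otimes> c)"
    using w(1) i(1) assms by (simp add: m_ac)
  also have "\<dots> = d" using w i assms by (simp add: m_assoc)
  finally show ?thesis using that[of "w \<otimes> inv c"] w i by simp
qed

lemma complete_free_nonsquare_graph:
  assumes t: "t = 2 * m + 1"
  shows "complete_free t (nonsquare_graph t)"
  unfolding complete_free_def verts_nonsquare_graph
proof (rule notI, elim exE conjE)
  fix K assume K: "K \<subseteq> nonsquare_points t R" "finite K" "card K = t"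
    and clique: "clique K (edges (nonsquare_graph t))"
  obtain p where p: "bij_betw p {1..t} K" using ex_bij_betw_nat_finite_1[OF K(2)] K(3) by blast
  have pK: "p k \<in> nonsquare_points t R" if "k \<in> {1..t}" for k
    using p that K by (auto simp: bij_betw_def)
  \<comment> \<open>The norm of the first clique vertex serves as the common target; the other norms
    differ from it by square factors, so rescaling reaches it.\<close>
  define d where "d = dot t R (rep (p 1)) (rep (p 1))"
  have p1: "p 1 \<in> nonsquare_points t R" using t by (intro pK) auto
  have d: "d \<in> carrier R" "quad_char d = -1"
    unfolding d_def using p1 by (auto intro: dot_vecs_closed rep_closed rep_norm)
  have "\<exists>s\<in>carrier R. s \<otimes> (s \<otimes> dot t R (rep (p k)) (rep (p k))) = d" if "k \<in> {1..t}" for k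
  proof -
    note P = pK[OF that]
    obtain r where "r \<in> carrier R" "r \<otimes> (r \<otimes> dot t R (rep (p k)) (rep (p k))) = d"
      by (rule nonsquare_ratio_square[OF dot_vecs_closed[OF rep_closed[OF P] rep_closed[OF P]]
            d(1) rep_norm[OF P] d(2)])
    then show ?thesis by blast
  qed
  then obtain s where s: "\<And>k. k \<in> {1..t} \<Longrightarrow> s k \<in> carrier R"
    "\<And>k. k \<in> {1..t} \<Longrightarrow> s k \<otimes> (s k \<otimes> dot t R (rep (p k)) (rep (p k))) = d" by metis
  let ?b = "\<lambda>k. scale t (s k) (rep (p k))"
  have dot_b: "dot t R (?b k) (?b l) = s k \<otimes> (s l \<otimes> dot t R (rep (p k)) (rep (p l)))"
    if kl: "k \<in> {1..t}" "l \<in> {1..t}" for k l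
    using dot_scale_left[OF s(1)[OF kl(1)] rep_closed[OF pK[OF kl(1)]]
        scale_closed[OF s(1)[OF kl(2)] rep_closed[OF pK[OF kl(2)]]]]
      dot_scale_right[OF s(1)[OF kl(2)] rep_closed[OF pK[OF kl(1)]] rep_closed[OF pK[OF kl(2)]]]
    by simp
  have "orth t (p k) (p l)" if kl: "k \<in> {1..t}" "l \<in> {1..t}" "k \<noteq> l" for k l
  proof -
    have "p k \<noteq> p l" "p k \<in> K" "p l \<in> K" using p kl by (auto simp: bij_betw_def inj_on_eq_iff)
    then have "{p k, p l} \<in> edges (nonsquare_graph t)" using clique by (auto simp: clique_def)
    then obtain P Q where "{p k, p l} = {P, Q}" "orth t P Q"
      unfolding edges_nonsquare_graph by blast
    then have "orth t (p k) (p l) \<or> orth t (p l) (p k)" by (auto simp only: doubleton_eq_iff)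
    then show ?thesis using orth_commute[OF pK[OF kl(1)] pK[OF kl(2)]] by blast
  qed
  then have orth: "dot t R (?b k) (?b l) = (if k = l then d else \<zero>)" if "k \<in> {1..t}" "l \<in> {1..t}" for k l
    using dot_b[OF that] s(1)[OF that(1)] s(1)[OF that(2)] s(2)[OF that(1)] that
    by (cases "k = l") simp_all
  have "d \<noteq> \<zero>" using d by auto
  moreover have "?b \<in> {1..t} \<rightarrow> vecs t R" using s pK by (auto intro!: scale_closed rep_closed)
  ultimately have "rep_count t d = rep_count t \<one>"
    using rep_count_orthogonal_basis[OF d(1) _ _ orth] by blast
  \<comment> \<open>The leading terms q^(2 m) cancel, leaving u \<chi>(d) = u with u nonzero,
    although \<chi>(d) = -1.\<close>
  then have "(quad_char (\<ominus> \<one>) * int q) ^ m * quad_char d = (quad_char (\<ominus> \<one>) * int q) ^ m"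
    using rep_count_odd[OF d(1), of m] rep_count_odd[OF one_closed, of m] t by simp
  moreover have "quad_char (\<ominus> \<one>) \<noteq> 0"
    using quad_char_nonzero[OF uminus_one_nonzero] by auto
  ultimately show False using d order_ge_3 by simp
qed

section \<open>Jumbledness and the number of vertices\<close>

lemma jumbled_nonsquare_graph:
  assumes "t \<ge> 2"
  shows "jumbled (1 / real q) (sqrt (real q ^ (t - 2))) (nonsquare_graph t)"
  unfolding jumbled_def verts_nonsquare_graph
  using edge_count_discrepancy[OF _ _ assms] order_ge_3 by auto

text \<open>With u = q^m at least 3 one has u \<le> u^2 / 3, so u^2 \<plusminus> u lies between 2
  u^2 / 3 and 2 u^2; halving gives both bounds.\<close>

lemma card_nonsquare_points_bounds:
  fixes t :: nat
  assumes t: "t = 2 * m + 1" and m: "m \<ge> 1"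
  defines "n \<equiv> real (card (nonsquare_points t R))"
  shows "real q ^ (t - 1) / 3 \<le> n" and "n \<le> real q ^ (t - 1)"
proof -
  let ?u = "real q ^ m"
  obtain e :: int where "e \<in> {1, -1}"
    "2 * int (card (nonsquare_points t R)) = int q ^ (2 * m) + e * int q ^ m"
    using card_nonsquare_points[of m] t by blast
  then have "2 * n = real q ^ (2 * m) + ?u \<or> 2 * n = real q ^ (2 * m) - ?u"
    unfolding n_def by (auto dest: arg_cong[where f = real_of_int])
  moreover have "real q ^ (2 * m) = ?u * ?u" by (simp add: mult_2 power_add)
  moreover have "?u * ?u \<ge> 3 * ?u" and "?u \<ge> 0"
  proof -
    have "real q ^ 1 \<le> ?u" using order_ge_3 m by (intro power_increasing) auto
    moreover have "real q \<ge> 3" using order_ge_3 by simp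
    ultimately have "?u \<ge> 3" by (simp only: power_one_right)
    then show "?u * ?u \<ge> 3 * ?u" and "?u \<ge> 0" by (auto intro!: mult_right_mono)
  qed
  moreover have "real q ^ (t - 1) = real q ^ (2 * m)" using t by simp
  ultimately show "real q ^ (t - 1) / 3 \<le> n" "n \<le> real q ^ (t - 1)" by linarith+
qed

end

section \<open>Constants independent of q\<close>

theorem theorem4p3:
  fixes t :: nat
  assumes "t \<ge> 3" and "odd t"
  shows "\<exists>c1 c2 d1 d2 :: real. c1 > 0 \<and> c2 > 0 \<and> d1 > 0 \<and> d2 > 0 \<and>
    (\<forall>(q :: nat) (F :: 'a ring).
       odd q \<longrightarrow> primepow q \<longrightarrow> field F \<longrightarrow> finite (carrier F) \<longrightarrow> order F = q \<longrightarrow>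
       (let G = induced (AK t F) (nonsquare_points t F);
            n = real (card (nonsquare_points t F))
        in \<exists>p \<alpha> :: real.
             c1 * n powr (- 1 / (real t - 1)) \<le> p \<and> p \<le> c2 * n powr (- 1 / (real t - 1)) \<and>
             d1 * sqrt (n * p) \<le> \<alpha> \<and> \<alpha> \<le> d2 * sqrt (n * p) \<and>
             complete_free t G \<and> jumbled p \<alpha> G))"
proof -
  obtain m where t: "t = 2 * m + 1" using \<open>odd t\<close> by (rule oddE)
  have m: "m \<ge> 1" using t \<open>t \<ge> 3\<close> by simp
  define r where "r = - 1 / (real t - 1)"
  have r: "r \<le> 0" "(real t - 1) * r = -1" using \<open>t \<ge> 3\<close> by (auto simp: r_def)
  have main: "\<exists>p \<alpha>. (1/3) powr (- r) * n powr r \<le> p \<and> p \<le> 1 * n powr r \<and>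
      1 * sqrt (n * p) \<le> \<alpha> \<and> \<alpha> \<le> 2 * sqrt (n * p) \<and>
      complete_free t (induced (AK t F) (nonsquare_points t F)) \<and>
      jumbled p \<alpha> (induced (AK t F) (nonsquare_points t F))"
    if F: "field F" "finite (carrier F)" "odd (order F)"
      and n: "n = real (card (nonsquare_points t F))" for F :: "'a ring" and n
  proof -
    interpret odd_field F
      using F by (simp add: odd_field_def odd_field_axioms_def)
    let ?q = "real (order F)"
    have q: "?q \<ge> 3" using order_ge_3 by simp
    have bounds: "?q ^ (t - 1) / 3 \<le> n" "n \<le> ?q ^ (t - 1)"
      using card_nonsquare_points_bounds[OF t m] n by auto
    have Q: "?q ^ (t - 1) > 0" using q by simp
    then have npos: "n > 0" using bounds by linarith
    \<comment> \<open>The exponents t - 1 and r multiply to -1, so the bounds on n become bounds on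
      p = 1/q.\<close>
    have "(?q ^ (t - 1)) powr r = ?q powr ((real t - 1) * r)"
      using q \<open>t \<ge> 3\<close> by (simp add: powr_powr of_nat_diff flip: powr_realpow)
    also have "\<dots> = 1 / ?q" using q r by (simp add: powr_minus divide_inverse)
    finally have Qr: "(?q ^ (t - 1)) powr r = 1 / ?q" .
    \<comment> \<open>As r is not positive, raising to the power r reverses inequalities: the upper
      bound on n gives c2 = 1, the lower one gives c1.\<close>
    have upper: "1 / ?q \<le> n powr r"
      unfolding Qr[symmetric] using r npos bounds by (intro powr_mono2') auto
    have "n powr r \<le> (?q ^ (t - 1) / 3) powr r"
      using r Q bounds by (intro powr_mono2') auto
    also have "\<dots> = (1 / 3) powr r * (1 / ?q)"
      unfolding Qr[symmetric] using Q powr_mult[of "1/3" "?q ^ (t - 1)" r] by simp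
    finally have "(1/3) powr (- r) * n powr r \<le> (1/3) powr (- r) * ((1 / 3) powr r * (1 / ?q))"
      by (intro mult_left_mono) auto
    also have "\<dots> = 1 / ?q" by (simp flip: powr_add mult.assoc)
    finally have lower: "(1/3) powr (- r) * n powr r \<le> 1 / ?q" .
    have qt: "?q ^ (t - 1) = ?q ^ (t - 2) * ?q"
    proof -
      have "t - 1 = Suc (t - 2)" using \<open>t \<ge> 3\<close> by simp
      then show ?thesis by simp
    qed
    \<comment> \<open>The bounds on n would allow the factor 3; taking 4 makes the square root an
      integer and yields d2 = 2.\<close>
    have "n * (1 / ?q) \<le> ?q ^ (t - 2)" "?q ^ (t - 2) \<le> 4 * (n * (1 / ?q))"
      using bounds q npos unfolding qt by (auto simp: field_simps)
    then have sqrt: "sqrt (n * (1 / ?q)) \<le> sqrt (?q ^ (t - 2))"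
      "sqrt (?q ^ (t - 2)) \<le> sqrt (4 * (n * (1 / ?q)))"
      using real_sqrt_le_mono by blast+
    have four: "sqrt (4 * (n * (1 / ?q))) = 2 * sqrt (n * (1 / ?q))"
      by (simp only: real_sqrt_mult real_sqrt_four)
    show ?thesis
    proof (intro exI conjI)
      show "jumbled (1 / ?q) (sqrt (?q ^ (t - 2))) (nonsquare_graph t)"
        using \<open>t \<ge> 3\<close> by (intro jumbled_nonsquare_graph) simp
      show "complete_free t (nonsquare_graph t)" by (rule complete_free_nonsquare_graph[OF t])
    qed (use lower upper sqrt four in \<open>simp_all only: mult_1\<close>)
  qed
  show ?thesis
    unfolding Let_def r_def[symmetric]
    by (rule exI[where x = "(1/3) powr (- r)"], rule exI[where x = 1], rule exI[where x = 1],
        rule exI[where x = 2], intro conjI allI impI main) auto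
qed

end
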